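(* Let $X_1,X_2,\ldots$ be independent identically distributed random variables with $\mathsf{E}X_1=0$ and $0<\mathsf{E}X_1^2=\sigma^2<\infty$ ($\sigma>0$). For $n\in\mathbb{N}$ let $N_n^\star$ have the geometric distribution $$\mathsf{P}(N_n^\star=k)=\frac{1}{n+1}\Big(\frac{n}{n+1}\Big)^k,\qquad k\in\mathbb{N}\cup\{0\},$$ with $N_n^\star,X_1,X_2,\ldots$ independent, and let $S_{N_n^\star}=X_1+\ldots+X_{N_n^\star}$ (equal to $0$ if $N_n^\star=0$). Then $$\sup_{z\ge 0}\Big|Q_{S_{N_n^\star}}(z)-1+\exp\Big\{-\frac{\sqrt{2}\,z}{2\sigma\sqrt{n}}\Big\}\Big|\le\frac{7.4184}{\sigma^2}\bigg\{\mathsf{E}\Big[X_1^2\,\gamma\Big(1,\frac{X_1^2}{n\sigma^2}\Big)\Big]+\frac{1}{\sigma\sqrt{n}}\,\mathsf{E}\Big[|X_1|^3\,\Gamma\Big(\frac12,\frac{X_1^2}{n\sigma^2}\Big)\Big]\bigg\}.$$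
   Context: The concentration function of a random variable $\xi$ is $Q_\xi(z)=\sup_{x\in\mathbb{R}}\mathsf{P}(x\le\xi\le x+z)$, $z\ge 0$. The incomplete gamma functions are $\Gamma(\alpha,z)=\int_z^\infty y^{\alpha-1}e^{-y}\,dy$ (upper) and $\gamma(\alpha,z)=\int_0^z y^{\alpha-1}e^{-y}\,dy$ (lower). *)

theory Defs
  imports "HOL-Probability.Probability"
begin

definition concentration_fun :: "'a measure \<Rightarrow> ('a \<Rightarrow> real) \<Rightarrow> real \<Rightarrow> real" where
  "concentration_fun M \<xi> z = (SUP x::real. \<P>(\<omega> in M. x \<le> \<xi> \<omega> \<and> \<xi> \<omega> \<le> x + z))"

text \<open>
  Incomplete gamma functions, meant for \<open>\<alpha> > 0\<close> and \<open>z \<ge> 0\<close>. The convention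
  \<open>0 powr a = 0\<close> changes the integrands only at the single point \<open>y = 0\<close>.
\<close>

definition upper_gamma :: "real \<Rightarrow> real \<Rightarrow> real" where
  "upper_gamma \<alpha> z = (LBINT y:{z..}. y powr (\<alpha> - 1) * exp (- y))"

definition lower_gamma :: "real \<Rightarrow> real \<Rightarrow> real" where
  "lower_gamma \<alpha> z = (LBINT y:{0..z}. y powr (\<alpha> - 1) * exp (- y))"

end

theory Submission
  imports Defs
begin

text \<open>
  Rescale so that the sum \<open>S\<close> has variance 1 and write \<open>Y\<close> for a summand, so \<open>n E Y\<^sup>2 = 1\<close>.
  Memorylessness of the geometric law gives \<open>(n + 1) E h(S) = h(0) + n E h(S + Y)\<close> with \<open>Y\<close>
  independent of \<open>S\<close>. For \<open>h(x) = P(a \<le> x + L \<le> b)\<close> with \<open>L\<close> a Laplace variable, \<open>h'' = 2 (h - f)\<close>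
  where \<open>f\<close> is the indicator of \<open>{a..b}\<close>, so a second order Taylor expansion leaves
  \<open>P(a \<le> S \<le> b) - P(a \<le> L \<le> b) = n E R\<close> with
  \<open>R = Y\<^sup>2 \<integral> (1 - v) (h''(S + v Y) - h''(S)) dv\<close> over \<open>0 \<le> v \<le> 1\<close>.
  The increments of \<open>h\<close> are Lipschitz; those of \<open>f\<close> are controlled by the concentration of \<open>S\<close>,
  and the same identity with a Huber function \<open>h\<close> (\<open>h'' = 1\<close> on an interval, \<open>0\<close> outside)
  yields \<open>P(c \<le> S \<le> c + u) \<le> 2 (u + 2 w)\<close> as soon as \<open>n E (Y\<^sup>2; \<bar>Y\<bar> \<le> w) \<ge> 1/2\<close>.
  With \<open>g(y) = \<gamma>(1, y\<^sup>2) + \<bar>y\<bar> \<Gamma>(1/2, y\<^sup>2)\<close> and \<open>d = n E Y\<^sup>2 g(Y)\<close>, the right-hand side of the theorem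
  is \<open>7.4184 d\<close>; the choice \<open>w = 1.3 d\<close> gives the bound \<open>(4 * 1.3 + 2.2) d = 7.4 d\<close> when
  \<open>d \<le> 0.1348\<close>, and for larger \<open>d\<close> the claim is trivial since \<open>7.4184 d \<ge> 1\<close>.
\<close>

section \<open>Incomplete gamma functions\<close>

lemma lower_gamma_1:
  assumes "0 \<le> z"
  shows "lower_gamma 1 z = 1 - exp (- z)"
proof -
  have "lower_gamma 1 z = (LBINT y:{0..z}. exp (- y))"
    unfolding lower_gamma_def
  \<comment> \<open>Since \<open>0 powr 0 = 0\<close>, the two integrands differ at
    \<open>y = 0\<close>, so they agree only almost everywhere.\<close>
  proof (rule set_lebesgue_integral_cong_AE)
    show "AE y\<in>{0..z} in lborel. y powr (1 - 1) * exp (- y) = exp (- y)"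
      using AE_lborel_singleton[of "0::real"] by eventually_elim simp
  qed auto
  also have "\<dots> = - exp (- z) - (- exp (- 0))"
    unfolding set_lebesgue_integral_def
    by (subst integral_FTC_Icc_real[where F = "\<lambda>y. - exp (- y)", symmetric])
       (auto intro!: derivative_eq_intros continuous_intros simp: assms mult.commute)
  finally show ?thesis by simp
qed

lemma Gamma_half_integral:
  "set_integrable lborel {0..} (\<lambda>t::real. t powr (1/2 - 1) * exp (- t))"
  "(LBINT t:{0..}. t powr (1/2 - 1) * exp (- t)) = sqrt pi"
proof -
  let ?f = "\<lambda>t::real. indicator {0..} t * t powr (1/2 - 1) / exp t"
  have "(\<integral>\<^sup>+t. ennreal (?f t) \<partial>lborel) = ennreal (sqrt pi)"
    using Gamma_conv_nn_integral_real[of "1/2"] by (simp add: Gamma_one_half_real)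
  then have *: "has_bochner_integral lborel ?f (sqrt pi)"
    by (intro has_bochner_integral_nn_integral) auto
  have eq: "?f = (\<lambda>t. indicator {0..} t *\<^sub>R (t powr (1/2 - 1) * exp (- t)))"
    by (auto simp: exp_minus field_simps)
  show "set_integrable lborel {0..} (\<lambda>t::real. t powr (1/2 - 1) * exp (- t))"
    using * unfolding set_integrable_def eq by (rule integrable.intros)
  show "(LBINT t:{0..}. t powr (1/2 - 1) * exp (- t)) = sqrt pi"
    using * unfolding set_lebesgue_integral_def eq by (rule has_bochner_integral_integral_eq)
qed

lemma upper_gamma_half_nonneg: "0 \<le> upper_gamma (1/2) z"
  unfolding upper_gamma_def set_lebesgue_integral_def by (intro integral_nonneg_AE) auto

text \<open>The missing part of the full integral \<open>sqrt pi\<close> runs over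
  \<open>{0..<z}\<close>; dropping \<open>exp (- t) \<le> 1\<close> there leaves the integral of
  \<open>t powr (-1/2)\<close>, which is \<open>2 * sqrt z\<close>.\<close>

lemma upper_gamma_half_lower:
  assumes "0 \<le> z"
  shows "sqrt pi - 2 * sqrt z \<le> upper_gamma (1/2) z"
proof -
  let ?J = "\<lambda>t::real. t powr (1/2 - 1) * exp (- t)"
  have int: "set_integrable lborel A ?J" if "A \<subseteq> {0..}" "A \<in> sets borel" for A
    by (rule set_integrable_subset[OF Gamma_half_integral(1)]) (use that in auto)
  have split: "{0..} = {0..<z} \<union> {z..}" using assms by auto
  have "sqrt pi = (LBINT t:{0..<z}. ?J t) + upper_gamma (1/2) z"
  proof -
    have "{0..<z} \<inter> {z..} = {}" "{0..<z} \<subseteq> {0..}" "{z..} \<subseteq> {0..}" using assms by auto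
    then have "(LBINT t:{0..<z} \<union> {z..}. ?J t) = (LBINT t:{0..<z}. ?J t) + (LBINT t:{z..}. ?J t)"
      by (intro set_integral_Un int) measurable
    then show ?thesis
      unfolding upper_gamma_def Gamma_half_integral(2)[symmetric] split[symmetric] .
  qed
  moreover have "(LBINT t:{0..<z}. ?J t) \<le> 2 * sqrt z"
  proof -
    have J: "set_integrable lborel {0..<z} ?J" by (intro int) auto
    have p: "((\<lambda>t. t powr (-1/2)) has_integral (2 * sqrt z)) {0..z}"
      using has_integral_powr_from_0[of "-1/2" z] assms by (simp add: powr_half_sqrt field_simps)
    have "((\<lambda>t. ?J t) has_integral (LBINT t:{0..<z}. ?J t)) {0..<z}"
      using set_borel_integral_eq_integral[OF J] by (simp add: has_integral_iff)
    moreover have "(?J has_integral i) {0..<z} \<longleftrightarrow> (?J has_integral i) {0..z}" for i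
    proof (rule has_integral_spike_set_eq)
      show "negligible {t \<in> {0..<z} - {0..z}. ?J t \<noteq> 0}"
        by (rule negligible_subset[OF negligible_empty]) auto
      show "negligible {t \<in> {0..z} - {0..<z}. ?J t \<noteq> 0}"
        by (rule negligible_subset[OF negligible_sing[of z]]) auto
    qed
    ultimately have "(?J has_integral (LBINT t:{0..<z}. ?J t)) {0..z}" by blast
    then show ?thesis
      by (rule has_integral_le[OF _ p]) (simp add: mult_left_le)
  qed
  ultimately show ?thesis by simp
qed

text \<open>On the range \<open>t \<ge> z\<close> the factor \<open>sqrt z * t powr (-1/2)\<close>
  is at most 1, so the product is dominated by the integral of \<open>exp (- t)\<close> over
  \<open>{z..}\<close>.\<close>

lemma upper_gamma_half_upper:
  assumes "0 < z"
  shows "sqrt z * upper_gamma (1/2) z \<le> 1"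
proof -
  let ?J = "\<lambda>t::real. t powr (1/2 - 1) * exp (- t)"
  have "(\<integral>\<^sup>+t. ennreal (exp (- t)) * indicator {z..} t \<partial>lborel) = 0 - (- exp (- z))"
  proof (rule nn_integral_FTC_atLeast[where F = "\<lambda>t. - exp (- t)"])
    show "((\<lambda>t::real. - exp (- t)) \<longlongrightarrow> 0) at_top"
      using tendsto_minus[OF filterlim_compose[OF exp_at_bot filterlim_uminus_at_bot_at_top]] by simp
  qed (auto intro!: derivative_eq_intros)
  then have e: "has_bochner_integral lborel (\<lambda>t. exp (- t) * indicator {z..} t) (exp (- z))"
    by (intro has_bochner_integral_nn_integral) (auto simp: ennreal_mult'' ennreal_indicator)
  have "sqrt z * upper_gamma (1/2) z = (\<integral>t. sqrt z * (indicator {z..} t * ?J t) \<partial>lborel)"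
    unfolding upper_gamma_def set_lebesgue_integral_def by simp
  also have "\<dots> \<le> (\<integral>t. exp (- t) * indicator {z..} t \<partial>lborel)"
  proof (rule integral_mono)
    have "set_integrable lborel {z..} ?J"
      by (rule set_integrable_subset[OF Gamma_half_integral(1)]) (use assms in auto)
    then show "integrable lborel (\<lambda>t. sqrt z * (indicator {z..} t * ?J t))"
      unfolding set_integrable_def by simp
    show "integrable lborel (\<lambda>t. exp (- t) * indicator {z..} t)"
      using e by (rule integrable.intros)
    show "sqrt z * (indicator {z..} t * ?J t) \<le> exp (- t) * indicator {z..} t" for t
    proof (cases "t \<ge> z")
      case True
      have "sqrt z * t powr (-(1/2)) \<le> sqrt t * t powr (-(1/2))"
        using True by (intro mult_right_mono) auto
      also have "\<dots> = 1"
        using True assms by (simp add: powr_minus powr_half_sqrt)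
      finally have "(sqrt z * t powr (-(1/2))) * exp (- t) \<le> 1 * exp (- t)"
        by (intro mult_right_mono) auto
      then show ?thesis using True by (simp add: mult.assoc)
    qed auto
  qed
  also have "\<dots> = exp (- z)"
    using has_bochner_integral_integral_eq[OF e] by simp
  also have "\<dots> \<le> 1" using assms by simp
  finally show ?thesis .
qed

lemma upper_gamma_measurable [measurable]: "upper_gamma \<alpha> \<in> borel_measurable borel"
proof -
  have "(\<lambda>z. \<integral>t. (if z \<le> t then t powr (\<alpha> - 1) * exp (- t) else 0) \<partial>lborel) \<in> borel_measurable borel"
    by measurable
  also have "(\<lambda>z. \<integral>t. (if z \<le> t then t powr (\<alpha> - 1) * exp (- t) else 0) \<partial>lborel) = upper_gamma \<alpha>"
    unfolding upper_gamma_def set_lebesgue_integral_def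
    by (intro ext Bochner_Integration.integral_cong) auto
  finally show ?thesis .
qed

section \<open>The weight combining both gamma functions, and its lower bounds\<close>

text \<open>This is the function \<open>g\<close> of the introduction, with the lower gamma function
  already in the closed form of \<open>lower_gamma_1\<close>.\<close>

definition gamma_weight :: "real \<Rightarrow> real" where
  "gamma_weight y = (1 - exp (- y\<^sup>2)) + \<bar>y\<bar> * upper_gamma (1/2) (y\<^sup>2)"

lemma gamma_weight_measurable [measurable]: "gamma_weight \<in> borel_measurable borel"
  unfolding gamma_weight_def[abs_def] by measurable

lemma gamma_weight_nonneg: "0 \<le> gamma_weight y"
  unfolding gamma_weight_def using upper_gamma_half_nonneg[of "y\<^sup>2"] by simp

text \<open>Each of the two summands is at most 1. Boundedness makes
  \<open>y\<^sup>2 * gamma_weight y\<close> integrable as soon as the second moment is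
  finite.\<close>

lemma gamma_weight_le_2: "gamma_weight y \<le> 2"
proof (cases "y = 0")
  case False
  then have "\<bar>y\<bar> * upper_gamma (1/2) (y\<^sup>2) \<le> 1"
    using upper_gamma_half_upper[of "y\<^sup>2"] by simp
  then show ?thesis unfolding gamma_weight_def using exp_ge_zero[of "- y\<^sup>2"] by linarith
qed (simp add: gamma_weight_def)

text \<open>Only the exponential summand is kept, with
  \<open>exp (y\<^sup>2) \<ge> 1 + y\<^sup>2\<close>. This is the bound for large arguments.\<close>

lemma gamma_weight_ge_rational: "y\<^sup>2 / (1 + y\<^sup>2) \<le> gamma_weight y"
proof -
  have "exp (- y\<^sup>2) \<le> 1 / (1 + y\<^sup>2)"
    using exp_ge_add_one_self[of "y\<^sup>2"] by (simp add: exp_minus field_simps add_pos_nonneg)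
  moreover have "y\<^sup>2 / (1 + y\<^sup>2) = 1 - 1 / (1 + y\<^sup>2)"
    using zero_le_power2[of y] by (simp add: divide_simps add_nonneg_eq_0_iff)
  ultimately show ?thesis
    unfolding gamma_weight_def
    using mult_nonneg_nonneg[OF abs_ge_zero upper_gamma_half_nonneg, of y "y\<^sup>2"] by linarith
qed

lemma sqrt_pi_gt: "177/100 < sqrt pi"
  by (rule real_less_rsqrt) (use pi_approx in \<open>simp add: power2_eq_square\<close>)

text \<open>The bound for small arguments: it adds \<open>upper_gamma_half_lower\<close>, with 1.77
  in place of \<open>sqrt pi\<close>, and the quadratic Taylor bound for the exponential.\<close>

lemma gamma_weight_ge_poly:
  "\<bar>y\<bar> * (177/100 - \<bar>y\<bar> - \<bar>y\<bar> ^ 3 / 2) \<le> gamma_weight y"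
proof -
  have "exp (- y\<^sup>2) \<le> 1 - y\<^sup>2 + (y\<^sup>2)\<^sup>2 / 2"
  proof -
    have "1 + y\<^sup>2 + (y\<^sup>2)\<^sup>2 / 2 \<le> exp (y\<^sup>2)" by (rule exp_lower_Taylor_quadratic) simp
    then have "exp (- y\<^sup>2) \<le> 1 / (1 + y\<^sup>2 + (y\<^sup>2)\<^sup>2 / 2)"
      by (simp add: exp_minus field_simps add_pos_nonneg)
    also have "\<dots> \<le> 1 - y\<^sup>2 + (y\<^sup>2)\<^sup>2 / 2"
    proof -
      define z where "z = y\<^sup>2"
      have z: "0 \<le> z" by (simp add: z_def)
      \<comment> \<open>The product exceeds 1, so the lower Taylor bound for \<open>exp z\<close>
        inverts to an upper bound for \<open>exp (- z)\<close>.\<close>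
      have "(1 - z + z\<^sup>2 / 2) * (1 + z + z\<^sup>2 / 2) = 1 + z ^ 4 / 4"
        by (simp add: field_simps power2_eq_square power4_eq_xxxx)
      moreover have "0 \<le> z ^ 4" using z by simp
      moreover have "0 < 1 + z + z\<^sup>2 / 2" using z by (simp add: add_pos_nonneg)
      ultimately have "1 / (1 + z + z\<^sup>2 / 2) \<le> 1 - z + z\<^sup>2 / 2"
        by (simp add: divide_le_eq)
      then show ?thesis by (simp add: z_def)
    qed
    finally show ?thesis .
  qed
  moreover have "\<bar>y\<bar> * (177/100 - 2 * \<bar>y\<bar>) \<le> \<bar>y\<bar> * upper_gamma (1/2) (y\<^sup>2)"
    using upper_gamma_half_lower[of "y\<^sup>2"] sqrt_pi_gt by (intro mult_left_mono) auto
  moreover have "\<bar>y\<bar> * (177/100 - \<bar>y\<bar> - \<bar>y\<bar> ^ 3 / 2)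
      = \<bar>y\<bar> * (177/100 - 2 * \<bar>y\<bar>) + (y\<^sup>2 - (y\<^sup>2)\<^sup>2 / 2)"
  proof -
    have "y\<^sup>2 = \<bar>y\<bar>\<^sup>2" by simp
    then show ?thesis by algebra
  qed
  ultimately show ?thesis unfolding gamma_weight_def by linarith
qed

text \<open>The bracket in \<open>gamma_weight_ge_poly\<close> decreases in the modulus of
  \<open>y\<close>, so its value at \<open>r\<close> is a valid slope on the whole range.\<close>

lemma gamma_weight_ge_mult:
  assumes "\<bar>y\<bar> \<le> r"
  shows "\<bar>y\<bar> * (177/100 - r - r ^ 3 / 2) \<le> gamma_weight y"
proof -
  have "\<bar>y\<bar> ^ 3 \<le> r ^ 3" using assms by (intro power_mono) auto
  then have "\<bar>y\<bar> * (177/100 - r - r ^ 3 / 2) \<le> \<bar>y\<bar> * (177/100 - \<bar>y\<bar> - \<bar>y\<bar> ^ 3 / 2)"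
    using assms by (intro mult_left_mono diff_mono) auto
  then show ?thesis using gamma_weight_ge_poly[of y] by linarith
qed

lemma gamma_weight_ge_const:
  assumes "0 \<le> r" "r \<le> \<bar>y\<bar>"
  shows "r\<^sup>2 / (1 + r\<^sup>2) \<le> gamma_weight y"
proof -
  have "r\<^sup>2 \<le> y\<^sup>2" using assms power_mono[of r "\<bar>y\<bar>" 2] by simp
  then have "r\<^sup>2 / (1 + r\<^sup>2) \<le> y\<^sup>2 / (1 + y\<^sup>2)"
    by (simp add: divide_simps add_nonneg_eq_0_iff add_pos_nonneg algebra_simps)
  then show ?thesis using gamma_weight_ge_rational[of y] by linarith
qed

text \<open>This justifies the choice \<open>w = 1.3 * d\<close>: outside \<open>{-w..w}\<close> the
  weight is at least twice its mean \<open>d\<close>, so a Markov argument leaves at least half of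
  the variance inside.\<close>

lemma gamma_weight_ge_double:
  assumes "d \<le> 0.1348" "1.3 * d < \<bar>y\<bar>"
  shows "2 * d \<le> gamma_weight y"
proof -
  \<comment> \<open>Up to 0.2 the slope is 1.566, and 1.3 * 1.566 exceeds 2. On the other three
    ranges the weight itself exceeds 0.2696 = 2 * 0.1348, which bounds \<open>2 * d\<close>.\<close>
  consider "\<bar>y\<bar> \<le> 2/10" | "2/10 \<le> \<bar>y\<bar>" "\<bar>y\<bar> \<le> 35/100" | "35/100 \<le> \<bar>y\<bar>" "\<bar>y\<bar> \<le> 7/10"
    | "7/10 \<le> \<bar>y\<bar>" by linarith
  then show ?thesis
  proof cases
    case 1 from gamma_weight_ge_mult[OF this] assms show ?thesis by (simp add: power3_eq_cube)
  next
    case 2 from gamma_weight_ge_mult[OF 2(2)] 2 assms show ?thesis by (simp add: power3_eq_cube)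
  next
    case 3 from gamma_weight_ge_mult[OF 3(2)] 3 assms show ?thesis by (simp add: power3_eq_cube)
  next
    case 4 from gamma_weight_ge_const[OF _ 4] assms show ?thesis by (simp add: power2_eq_square)
  qed
qed

text \<open>The left-hand side is the part of the remainder bound in
  \<open>remainder_mean_le\<close> that does not involve \<open>w\<close>; the constant 2.2 is what
  the comparison with \<open>gamma_weight\<close> costs.\<close>

lemma min_sum_le_gamma_weight:
  "min 1 (sqrt 2 * \<bar>y\<bar> / 6) + min 1 (2 * \<bar>y\<bar> / 3) \<le> 2.2 * gamma_weight y"
proof -
  let ?m = "min 1 (sqrt 2 * \<bar>y\<bar> / 6) + min 1 (2 * \<bar>y\<bar> / 3)"
  have "sqrt 2 \<le> 1415/1000" by (rule real_le_lsqrt) (auto simp: power2_eq_square)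
  then have "sqrt 2 * \<bar>y\<bar> \<le> 1415/1000 * \<bar>y\<bar>" by (intro mult_right_mono) auto
  \<comment> \<open>In \<open>m1\<close> both minima are replaced by their linear arguments, with
    slopes adding up to 5415/6000 = 361/400; in \<open>m2\<close> the second minimum, and in
    \<open>m3\<close> both, are replaced by 1.\<close>
  then have m1: "?m \<le> 1415/6000 * \<bar>y\<bar> + 2/3 * \<bar>y\<bar>" and m2: "?m \<le> 1 + 1415/6000 * \<bar>y\<bar>" and m3: "?m \<le> 2"
    by linarith+
  consider "\<bar>y\<bar> \<le> 7/10" | "7/10 \<le> \<bar>y\<bar>" "\<bar>y\<bar> \<le> 3/2" | "3/2 \<le> \<bar>y\<bar>" "\<bar>y\<bar> \<le> 2"
    | "2 \<le> \<bar>y\<bar>" "\<bar>y\<bar> \<le> 3" | "3 \<le> \<bar>y\<bar>" "\<bar>y\<bar> \<le> 7/2" | "7/2 \<le> \<bar>y\<bar>" by linarith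
  then show ?thesis
  proof cases
    case 1
    have "\<bar>y\<bar> * (1797/2000) \<le> gamma_weight y"
      using gamma_weight_ge_mult[OF 1] by (simp add: power3_eq_cube)
    then show ?thesis using m1 abs_ge_zero[of y] by linarith
  next
    case 2
    define s where "s = \<bar>y\<bar>"
    \<comment> \<open>The sign of this product says that the parabola lies below its chord on the
      range, which linearises \<open>s\<^sup>2\<close>.\<close>
    have s: "0 \<le> (s - 7/10) * (3/2 - s)" "0 \<le> s" "y\<^sup>2 = s\<^sup>2" "7/10 \<le> s" using 2 by (auto simp: s_def)
    have "(s - 7/10) * (3/2 - s) = 22/10 * s - s\<^sup>2 - 105/100"
      by (simp add: field_simps power2_eq_square)
    then have "s\<^sup>2 \<le> 22/10 * s - 105/100" using s(1) by linarith
    then have "361/400 * (1 + s\<^sup>2) \<le> 2.2 * s" using s(4) by simp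
    then have "(361/400 * (1 + s\<^sup>2)) * s \<le> (2.2 * s) * s"
      using s(2) by (rule mult_right_mono)
    then have "361/400 * s \<le> 2.2 * s\<^sup>2 / (1 + s\<^sup>2)"
      by (subst pos_le_divide_eq) (simp_all add: add_pos_nonneg power2_eq_square mult_ac)
    moreover have "2.2 * s\<^sup>2 / (1 + s\<^sup>2) \<le> 2.2 * gamma_weight y"
      unfolding s(3)[symmetric] times_divide_eq_right[symmetric]
      by (intro mult_left_mono gamma_weight_ge_rational) simp
    ultimately show ?thesis using m1 s_def by linarith
  next
    case 3
    have "9/13 \<le> gamma_weight y"
      using gamma_weight_ge_const[OF _ 3(1)] by (simp add: power2_eq_square)
    then show ?thesis using m2 3 by linarith
  next
    case 4
    have "4/5 \<le> gamma_weight y"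
      using gamma_weight_ge_const[OF _ 4(1)] by (simp add: power2_eq_square)
    then show ?thesis using m2 4 by linarith
  next
    case 5
    have "9/10 \<le> gamma_weight y"
      using gamma_weight_ge_const[OF _ 5(1)] by (simp add: power2_eq_square)
    then show ?thesis using m2 5 by linarith
  next
    case 6
    have "49/53 \<le> gamma_weight y"
      using gamma_weight_ge_const[OF _ 6] by (simp add: power2_eq_square)
    then show ?thesis using m3 6 by linarith
  qed
qed

section \<open>The Laplace distribution\<close>

text \<open>The Laplace law with variance 1. With \<open>min\<close> and \<open>max\<close> one
  formula covers both signs: for \<open>t \<le> 0\<close> the second term vanishes, for
  \<open>t \<ge> 0\<close> the first equals 1/2. Continuity and monotonicity can then be read
  off.\<close>

definition laplace_cdf :: "real \<Rightarrow> real" where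
  "laplace_cdf t = exp (sqrt 2 * min t 0) / 2 + (1 - exp (- sqrt 2 * max t 0)) / 2"

definition laplace_pdf :: "real \<Rightarrow> real" where
  "laplace_pdf t = exp (- sqrt 2 * \<bar>t\<bar>) / sqrt 2"

lemma laplace_cdf_neg: "t \<le> 0 \<Longrightarrow> laplace_cdf t = exp (sqrt 2 * t) / 2"
  and laplace_cdf_pos: "0 \<le> t \<Longrightarrow> laplace_cdf t = 1 - exp (- sqrt 2 * t) / 2"
  by (auto simp: laplace_cdf_def field_simps)

lemma continuous_on_laplace [continuous_intros]:
  assumes "continuous_on A f"
  shows "continuous_on A (\<lambda>x. laplace_cdf (f x))" "continuous_on A (\<lambda>x. laplace_pdf (f x))"
  unfolding laplace_cdf_def laplace_pdf_def by (intro continuous_intros assms; simp)+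

lemma laplace_measurable [measurable]:
  "laplace_cdf \<in> borel_measurable borel" "laplace_pdf \<in> borel_measurable borel"
  by (intro borel_measurable_continuous_onI continuous_intros)+

lemma laplace_pdf_bounds: "0 \<le> laplace_pdf t" "laplace_pdf t \<le> 1"
proof -
  have "exp (- (sqrt 2 * \<bar>t\<bar>)) \<le> sqrt 2"
    by (rule order_trans[of _ 1]) auto
  then show "0 \<le> laplace_pdf t" "laplace_pdf t \<le> 1"
    by (auto simp: laplace_pdf_def divide_le_eq)
qed

lemma laplace_cdf_mono: "s \<le> t \<Longrightarrow> laplace_cdf s \<le> laplace_cdf t"
  unfolding laplace_cdf_def by (intro add_mono divide_right_mono diff_mono) auto

lemma laplace_cdf_bounds: "0 \<le> laplace_cdf t" "laplace_cdf t \<le> 1"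
proof -
  have "0 \<le> laplace_cdf t \<and> laplace_cdf t \<le> 1"
  proof (cases "t \<le> 0")
    case True
    then have "exp (sqrt 2 * t) \<le> 1" by (simp add: mult_le_0_iff)
    then have "exp (sqrt 2 * t) \<le> 2" by linarith
    then show ?thesis using True by (simp add: laplace_cdf_neg)
  next
    case False
    then have "exp (- sqrt 2 * t) \<le> 1" by simp
    then have "exp (- sqrt 2 * t) \<le> 2" by linarith
    then show ?thesis using False by (simp add: laplace_cdf_pos)
  qed
  then show "0 \<le> laplace_cdf t" "laplace_cdf t \<le> 1" by auto
qed

text \<open>Among intervals of length \<open>z\<close> the one centred at 0 carries the most mass.
  With \<open>q\<close> the square root of \<open>exp (- sqrt 2 * z)\<close>, an interval on one
  side of 0 has mass at most \<open>(1 - q\<^sup>2) / 2\<close>, which is below \<open>1 - q\<close>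
  because \<open>(1 - q)\<^sup>2 \<ge> 0\<close>.\<close>

lemma laplace_cdf_diff_le:
  assumes "0 \<le> z"
  shows "laplace_cdf (x + z) - laplace_cdf x \<le> 1 - exp (- (sqrt 2 * z / 2))"
proof -
  define q where "q = exp (- (sqrt 2 * z / 2))"
  have q: "0 < q" "q \<le> 1" using assms by (auto simp: q_def)
  have q2: "exp (- sqrt 2 * z) = q\<^sup>2" by (simp add: q_def exp_double[symmetric])
  have fac: "e * (1 - q\<^sup>2) / 2 \<le> 1 - q" if "0 \<le> e" "e \<le> 1" for e
  proof -
    define p where "p = 1 - q\<^sup>2"
    have "0 \<le> p" using q by (simp add: p_def power_le_one)
    then have "e * p \<le> p" using that by (simp add: mult_left_le_one_le)
    moreover have "0 \<le> (1 - q)\<^sup>2" by simp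
    then have "p \<le> 2 - 2 * q" by (simp add: power2_diff p_def)
    ultimately have "e * p / 2 \<le> 1 - q" by linarith
    then show ?thesis by (simp add: p_def)
  qed
  consider "0 \<le> x" | "x + z \<le> 0" | "x \<le> 0" "0 \<le> x + z" by linarith
  then have "laplace_cdf (x + z) - laplace_cdf x \<le> 1 - q"
  proof cases
    case 1
    have "exp (- sqrt 2 * (x + z)) = exp (- sqrt 2 * x) * q\<^sup>2"
      unfolding q2[symmetric] by (simp add: exp_add[symmetric] algebra_simps)
    then have "laplace_cdf (x + z) - laplace_cdf x = exp (- sqrt 2 * x) * (1 - q\<^sup>2) / 2"
      using 1 assms by (simp add: laplace_cdf_pos field_simps)
    then show ?thesis using fac[of "exp (- sqrt 2 * x)"] 1 by simp
  next
    case 2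
    have "exp (sqrt 2 * x) = exp (sqrt 2 * (x + z)) * q\<^sup>2"
      unfolding q2[symmetric] by (simp add: exp_add[symmetric] algebra_simps)
    then have "laplace_cdf (x + z) - laplace_cdf x = exp (sqrt 2 * (x + z)) * (1 - q\<^sup>2) / 2"
      using 2 assms by (simp add: laplace_cdf_neg field_simps)
    moreover have "exp (sqrt 2 * (x + z)) \<le> 1" using 2 by (simp add: mult_le_0_iff)
    ultimately show ?thesis using fac[of "exp (sqrt 2 * (x + z))"] by simp
  next
    case 3
    \<comment> \<open>For an interval containing 0 the two tails are \<open>u\<^sup>2 / 2\<close>
      and \<open>v\<^sup>2 / 2\<close>, and \<open>u * v = q\<close> is independent of the position
      \<open>x\<close>; the claim becomes the inequality of arithmetic and geometric means.\<close>
    define u v where "u = exp (sqrt 2 * x / 2)" and "v = exp (- (sqrt 2 * (x + z) / 2))"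
    have uv: "u * v = q" by (simp add: u_def v_def q_def exp_add[symmetric] field_simps)
    have "exp (sqrt 2 * x) = u\<^sup>2" "exp (- sqrt 2 * (x + z)) = v\<^sup>2"
      by (simp_all add: u_def v_def exp_double[symmetric])
    then have "laplace_cdf (x + z) - laplace_cdf x = 1 - (u\<^sup>2 + v\<^sup>2) / 2"
      using 3 by (simp add: laplace_cdf_pos laplace_cdf_neg field_simps)
    moreover have "0 \<le> (u - v)\<^sup>2" by simp
    then have "2 * q \<le> u\<^sup>2 + v\<^sup>2" by (simp add: power2_diff uv[symmetric])
    ultimately show ?thesis by simp
  qed
  then show ?thesis by (simp add: q_def)
qed

text \<open>Equality case of \<open>laplace_cdf_diff_le\<close>; together they identify the
  concentration function of the Laplace law.\<close>

lemma laplace_cdf_diff_symmetric: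
  "0 \<le> z \<Longrightarrow> laplace_cdf (z / 2) - laplace_cdf (- z / 2) = 1 - exp (- (sqrt 2 * z / 2))"
  by (simp add: laplace_cdf_pos laplace_cdf_neg)

lemma laplace_cdf_lipschitz:
  "\<bar>laplace_cdf t - laplace_cdf s\<bar> \<le> min 1 (sqrt 2 * \<bar>t - s\<bar> / 2)"
proof -
  have *: "\<bar>laplace_cdf (x + z) - laplace_cdf x\<bar> \<le> min 1 (sqrt 2 * z / 2)" if "0 \<le> z" for x z
  proof -
    have "1 - sqrt 2 * z / 2 \<le> exp (- (sqrt 2 * z / 2))"
      using exp_ge_add_one_self[of "- (sqrt 2 * z / 2)"] by simp
    then show ?thesis
      using laplace_cdf_diff_le[OF that, of x] laplace_cdf_mono[of x "x + z"] that
        exp_ge_zero[of "- (sqrt 2 * z / 2)"] by linarith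
  qed
  show ?thesis
  proof (cases "s \<le> t")
    case True then show ?thesis using *[of "t - s" s] by simp
  next
    case False then show ?thesis using *[of "s - t" t] by (simp add: abs_minus_commute)
  qed
qed

lemma laplace_cdf_deriv:
  assumes "t \<noteq> 0"
  shows "(laplace_cdf has_real_derivative laplace_pdf t) (at t)"
proof (cases "0 < t")
  case True
  show ?thesis
  proof (rule has_field_derivative_transform_within_open[where S = "{0<..}"])
    show "((\<lambda>t. 1 - exp (- sqrt 2 * t) / 2) has_real_derivative laplace_pdf t) (at t)"
      using True by (auto intro!: derivative_eq_intros simp: laplace_pdf_def field_simps real_sqrt_mult_self)
  qed (use True in \<open>auto simp: laplace_cdf_pos\<close>)
next
  case False
  show ?thesis
  proof (rule has_field_derivative_transform_within_open[where S = "{..<0}"])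
    show "((\<lambda>t. exp (sqrt 2 * t) / 2) has_real_derivative laplace_pdf t) (at t)"
      using False by (auto intro!: derivative_eq_intros simp: laplace_pdf_def field_simps real_sqrt_mult_self)
  qed (use assms False in \<open>auto simp: laplace_cdf_neg\<close>)
qed

text \<open>Source of the equation \<open>h'' = 2 (h - f)\<close>: the difference of this identity
  at \<open>b - x\<close> and at \<open>a - x\<close> turns the step functions into the indicator of
  \<open>{a..b}\<close> away from the end points.\<close>

lemma laplace_pdf_deriv:
  assumes "t \<noteq> 0"
  shows "(laplace_pdf has_real_derivative 2 * (laplace_cdf t - indicator {0..} t)) (at t)"
proof (cases "0 < t")
  case True
  show ?thesis
  proof (rule has_field_derivative_transform_within_open[where S = "{0<..}"])
    show "((\<lambda>t. exp (- sqrt 2 * t) / sqrt 2) has_real_derivative 2 * (laplace_cdf t - indicator {0..} t)) (at t)"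
      using True by (auto intro!: derivative_eq_intros simp: laplace_cdf_pos)
  qed (use True in \<open>auto simp: laplace_pdf_def\<close>)
next
  case False
  show ?thesis
  proof (rule has_field_derivative_transform_within_open[where S = "{..<0}"])
    show "((\<lambda>t. exp (sqrt 2 * t) / sqrt 2) has_real_derivative 2 * (laplace_cdf t - indicator {0..} t)) (at t)"
      using False assms by (auto intro!: derivative_eq_intros simp: laplace_cdf_neg)
  qed (use assms False in \<open>auto simp: laplace_pdf_def\<close>)
qed

text \<open>For a Laplace variable \<open>L\<close> with variance 1, \<open>laplace_smooth a b x\<close> is the probability that
  \<open>x + L\<close> lies in \<open>{a..b}\<close>.\<close>

definition laplace_smooth :: "real \<Rightarrow> real \<Rightarrow> real \<Rightarrow> real" where
  "laplace_smooth a b x = laplace_cdf (b - x) - laplace_cdf (a - x)"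

definition laplace_smooth1 :: "real \<Rightarrow> real \<Rightarrow> real \<Rightarrow> real" where
  "laplace_smooth1 a b x = laplace_pdf (a - x) - laplace_pdf (b - x)"

text \<open>The second derivative of \<open>laplace_smooth\<close> away from \<open>a\<close> and
  \<open>b\<close>; at these two points, where it jumps, the differential equation fixes the
  value.\<close>

definition laplace_smooth2 :: "real \<Rightarrow> real \<Rightarrow> real \<Rightarrow> real" where
  "laplace_smooth2 a b x = 2 * (laplace_smooth a b x - indicator {a..b} x)"

lemma laplace_smooth_measurable [measurable]:
  "laplace_smooth a b \<in> borel_measurable borel"
  "laplace_smooth1 a b \<in> borel_measurable borel"
  "laplace_smooth2 a b \<in> borel_measurable borel"
  unfolding laplace_smooth_def[abs_def] laplace_smooth1_def[abs_def] laplace_smooth2_def[abs_def]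
  by measurable

lemma laplace_smooth_bounds:
  assumes "a \<le> b"
  shows "0 \<le> laplace_smooth a b x" "laplace_smooth a b x \<le> 1"
  using laplace_cdf_mono[of "a - x" "b - x"] laplace_cdf_bounds[of "a - x"] laplace_cdf_bounds[of "b - x"] assms
  by (auto simp: laplace_smooth_def)

lemma laplace_smooth1_bound: "\<bar>laplace_smooth1 a b x\<bar> \<le> 1"
  using laplace_pdf_bounds[of "a - x"] laplace_pdf_bounds[of "b - x"] by (auto simp: laplace_smooth1_def)

lemma laplace_smooth2_bound:
  assumes "a \<le> b"
  shows "\<bar>laplace_smooth2 a b x\<bar> \<le> 2"
  using laplace_smooth_bounds[OF assms, of x] by (auto simp: laplace_smooth2_def split: split_indicator)

text \<open>Both increments of the distribution function are nonnegative and at most the bound, so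
  their difference is no larger than either of them.\<close>

lemma laplace_smooth_lipschitz:
  "\<bar>laplace_smooth a b t - laplace_smooth a b s\<bar> \<le> min 1 (sqrt 2 * \<bar>t - s\<bar> / 2)"
proof -
  define m where "m = min 1 (sqrt 2 * \<bar>t - s\<bar> / 2)"
  have lip: "\<bar>laplace_cdf (c - t) - laplace_cdf (c - s)\<bar> \<le> m" for c
    using laplace_cdf_lipschitz[of "c - t" "c - s"] by (simp add: m_def abs_minus_commute)
  have "\<bar>laplace_smooth a b t - laplace_smooth a b s\<bar> \<le> m"
  proof (cases "s \<le> t")
    case True
    then show ?thesis
      using lip[of a] lip[of b] laplace_cdf_mono[of "a - t" "a - s"] laplace_cdf_mono[of "b - t" "b - s"]
      unfolding laplace_smooth_def by linarith
  next
    case False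
    then show ?thesis
      using lip[of a] lip[of b] laplace_cdf_mono[of "a - s" "a - t"] laplace_cdf_mono[of "b - s" "b - t"]
      unfolding laplace_smooth_def by linarith
  qed
  then show ?thesis by (simp add: m_def)
qed

lemma laplace_smooth_deriv:
  assumes "x \<noteq> a" "x \<noteq> b"
  shows "(laplace_smooth a b has_real_derivative laplace_smooth1 a b x) (at x)"
proof -
  have "((\<lambda>x. laplace_cdf (c - x)) has_real_derivative - laplace_pdf (c - x)) (at x)" if "x \<noteq> c" for c
  proof -
    have "((\<lambda>x. c - x) has_real_derivative -1) (at x)" by (auto intro!: derivative_eq_intros)
    then show ?thesis using DERIV_chain2[OF laplace_cdf_deriv, of "\<lambda>x. c - x" x "-1" UNIV] that by simp
  qed
  from DERIV_diff[OF this[OF assms(2)] this[OF assms(1)]] show ?thesis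
    by (simp add: laplace_smooth_def[abs_def] laplace_smooth1_def)
qed

lemma laplace_smooth1_deriv:
  assumes "a \<le> b" "x \<noteq> a" "x \<noteq> b"
  shows "(laplace_smooth1 a b has_real_derivative laplace_smooth2 a b x) (at x)"
proof -
  have "((\<lambda>x. laplace_pdf (c - x)) has_real_derivative - (2 * (laplace_cdf (c - x) - indicator {0..} (c - x)))) (at x)"
    if "x \<noteq> c" for c
  proof -
    have "((\<lambda>x. c - x) has_real_derivative -1) (at x)" by (auto intro!: derivative_eq_intros)
    then show ?thesis using DERIV_chain2[OF laplace_pdf_deriv, of "\<lambda>x. c - x" x "-1" UNIV] that by simp
  qed
  from DERIV_diff[OF this[OF assms(2)] this[OF assms(3)]] show ?thesis
    using assms
    by (auto simp: laplace_smooth_def[abs_def] laplace_smooth1_def[abs_def] laplace_smooth2_def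
        split: split_indicator elim!: DERIV_cong)
qed

section \<open>Second order Taylor expansion of the smoothed indicator\<close>

lemma integral_one_minus: "((\<lambda>v::real. 1 - v) has_integral 1/2) {0..1}"
  and integral_one_minus_mult: "((\<lambda>v::real. (1 - v) * v) has_integral 1/6) {0..1}"
proof -
  have "((\<lambda>v::real. 1 - v) has_integral (1 - 1\<^sup>2/2) - (0 - 0\<^sup>2/2)) {0..1}"
    by (rule fundamental_theorem_of_calculus)
       (auto intro!: derivative_eq_intros simp: has_real_derivative_iff_has_vector_derivative[symmetric])
  then show "((\<lambda>v::real. 1 - v) has_integral 1/2) {0..1}" by simp
  have "((\<lambda>v::real. (1 - v) * v) has_integral (1\<^sup>2/2 - 1^3/3) - (0\<^sup>2/2 - 0^3/3)) {0..1}"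
    by (rule fundamental_theorem_of_calculus)
       (auto intro!: derivative_eq_intros simp: has_real_derivative_iff_has_vector_derivative[symmetric]
          power2_eq_square algebra_simps)
  then show "((\<lambda>v::real. (1 - v) * v) has_integral 1/6) {0..1}" by simp
qed

text \<open>Taylor's formula with integral remainder. The second derivative jumps at
  \<open>a\<close> and \<open>b\<close>, hence the fundamental theorem of calculus is applied with
  finitely many exceptional points.\<close>

lemma laplace_smooth_taylor:
  assumes "a \<le> b"
  shows "laplace_smooth a b (s + y) - laplace_smooth a b s - y * laplace_smooth1 a b s
           - y\<^sup>2 / 2 * laplace_smooth2 a b s
       = y\<^sup>2 * (LBINT v:{0..1}. (1 - v) * (laplace_smooth2 a b (s + v * y) - laplace_smooth2 a b s))"
proof (cases "y = 0")
  case False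
  let ?h = "laplace_smooth a b" and ?h' = "laplace_smooth1 a b" and ?k = "laplace_smooth2 a b"
  \<comment> \<open>In the derivative of \<open>?F\<close> the first order terms cancel and
    \<open>(1 - v) * y\<^sup>2 * ?k (s + v * y)\<close> remains.\<close>
  let ?F = "\<lambda>v. ?h (s + v * y) + (1 - v) * y * ?h' (s + v * y)"
  have "((\<lambda>v. (1 - v) * y\<^sup>2 * ?k (s + v * y)) has_integral (?F 1 - ?F 0)) {0..1}"
  proof (rule fundamental_theorem_of_calculus_strong)
    show "finite {(a - s) / y, (b - s) / y}" by simp
    show "continuous_on {0..1} ?F"
      unfolding laplace_smooth_def laplace_smooth1_def by (intro continuous_intros)
    fix v assume "v \<in> {0..1} - {(a - s) / y, (b - s) / y}"
    then have x: "s + v * y \<noteq> a" "s + v * y \<noteq> b" using False by (auto simp: field_simps)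
    have d: "((\<lambda>v. s + v * y) has_real_derivative y) (at v)"
      by (auto intro!: derivative_eq_intros)
    show "(?F has_vector_derivative (1 - v) * y\<^sup>2 * ?k (s + v * y)) (at v)"
      unfolding has_real_derivative_iff_has_vector_derivative[symmetric]
      by (rule derivative_eq_intros DERIV_chain2[OF laplace_smooth_deriv[OF x] d]
           DERIV_chain2[OF laplace_smooth1_deriv[OF assms x] d] refl)+
         (simp add: power2_eq_square algebra_simps)
  qed auto
  then have "((\<lambda>v. (1 - v) * y\<^sup>2 * ?k (s + v * y) - (1 - v) * (y\<^sup>2 * ?k s)) has_integral
     (?F 1 - ?F 0) - 1/2 * (y\<^sup>2 * ?k s)) {0..1}"
    by (intro has_integral_diff has_integral_mult_left integral_one_minus)
  then have "((\<lambda>v. y\<^sup>2 * ((1 - v) * (?k (s + v * y) - ?k s))) has_integral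
     ?h (s + y) - ?h s - y * ?h' s - y\<^sup>2 / 2 * ?k s) {0..1}"
    by (simp add: algebra_simps)
  moreover have si: "set_integrable lborel {0..1} (\<lambda>v. (1 - v) * (?k (s + v * y) - ?k s))"
    unfolding set_integrable_def
  proof (rule integrableI_bounded_set_indicator[where B = 4])
    show "AE v in lborel. v \<in> {0..1} \<longrightarrow> norm ((1 - v) * (?k (s + v * y) - ?k s)) \<le> 4"
    proof (intro AE_I2 impI)
      fix v :: real assume "v \<in> {0..1}"
      moreover have "\<bar>?k (s + v * y) - ?k s\<bar> \<le> 4"
        using laplace_smooth2_bound[OF assms, of "s + v * y"] laplace_smooth2_bound[OF assms, of s] by linarith
      ultimately have "\<bar>1 - v\<bar> * \<bar>?k (s + v * y) - ?k s\<bar> \<le> 1 * 4"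
        by (intro mult_mono) auto
      then show "norm ((1 - v) * (?k (s + v * y) - ?k s)) \<le> 4" by (simp add: abs_mult)
    qed
  qed (auto simp: emeasure_lborel_Icc_eq)
  then have "((\<lambda>v. (1 - v) * (?k (s + v * y) - ?k s)) has_integral
     (LBINT v:{0..1}. (1 - v) * (?k (s + v * y) - ?k s))) {0..1}"
    using set_borel_integral_eq_integral[OF si] by (simp add: has_integral_iff)
  then have "((\<lambda>v. y\<^sup>2 * ((1 - v) * (?k (s + v * y) - ?k s))) has_integral
     y\<^sup>2 * (LBINT v:{0..1}. (1 - v) * (?k (s + v * y) - ?k s))) {0..1}"
    by (rule has_integral_mult_right)
  ultimately show ?thesis by (rule has_integral_unique)
qed simp

section \<open>Laws with a geometric mixture identity\<close>

lemma (in pair_prob_space) integrable_mult_product: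
  fixes f :: "'a \<Rightarrow> real" and g :: "'b \<Rightarrow> real"
  assumes f: "integrable M1 f" and g: "integrable M2 g"
  shows "integrable (M1 \<Otimes>\<^sub>M M2) (\<lambda>(x, y). f x * g y)"
    and "(\<integral>(x, y). f x * g y \<partial>(M1 \<Otimes>\<^sub>M M2)) = (\<integral>x. f x \<partial>M1) * (\<integral>y. g y \<partial>M2)"
proof -
  have [measurable]: "f \<in> borel_measurable M1" "g \<in> borel_measurable M2"
    using f g by auto
  show *: "integrable (M1 \<Otimes>\<^sub>M M2) (\<lambda>(x, y). f x * g y)"
  proof (rule Fubini_integrable)
    show "integrable M1 (\<lambda>x. \<integral>y. norm (case (x, y) of (x, y) \<Rightarrow> f x * g y) \<partial>M2)"
      using f by (simp add: abs_mult)
  qed (use g in auto)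
  show "(\<integral>(x, y). f x * g y \<partial>(M1 \<Otimes>\<^sub>M M2)) = (\<integral>x. f x \<partial>M1) * (\<integral>y. g y \<partial>M2)"
    using integral_fst'[OF *] by simp
qed

lemma (in pair_prob_space) integrable_fst_prob:
  fixes f :: "'a \<Rightarrow> real"
  assumes "integrable M1 f"
  shows "integrable (M1 \<Otimes>\<^sub>M M2) (\<lambda>(x, y). f x)"
    and "(\<integral>(x, y). f x \<partial>(M1 \<Otimes>\<^sub>M M2)) = (\<integral>x. f x \<partial>M1)"
  using integrable_mult_product[OF assms, of "\<lambda>_. 1"] by (simp_all add: M2.prob_space)

text \<open>The law \<open>S\<close> of a geometric sum of independent variables with law \<open>P\<close>, normalised to
  variance 1. The last assumption says that \<open>S\<close> is a mixture of the point mass at \<open>0\<close> (weight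
  \<open>1 / (m + 1)\<close>) and of the convolution of \<open>S\<close> and \<open>P\<close>.\<close>

locale geometric_law = S: prob_space S + P: prob_space P
  for S P :: "real measure" +
  fixes m :: real
  assumes sets_S [measurable_cong, simp]: "sets S = sets borel"
    and sets_P [measurable_cong, simp]: "sets P = sets borel"
    and m_pos: "0 < m"
    and P_square: "integrable P (\<lambda>y. y\<^sup>2)"
    and P_mean: "(\<integral>y. y \<partial>P) = 0"
    and P_var: "m * (\<integral>y. y\<^sup>2 \<partial>P) = 1"
    and S_square: "integrable S (\<lambda>s. s\<^sup>2)"
    and S_var: "(\<integral>s. s\<^sup>2 \<partial>S) = 1"
    and mixture: "\<And>h :: real \<Rightarrow> ennreal. h \<in> borel_measurable borel \<Longrightarrow>
      ennreal (m + 1) * (\<integral>\<^sup>+s. h s \<partial>S) = h 0 + ennreal m * (\<integral>\<^sup>+s. \<integral>\<^sup>+y. h (s + y) \<partial>P \<partial>S)"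
begin

sublocale SP: pair_prob_space S P ..

lemma space_S [simp]: "space S = UNIV" and space_P [simp]: "space P = UNIV"
  using sets_eq_imp_space_eq[OF sets_S] sets_eq_imp_space_eq[OF sets_P] by auto

lemma prob_UNIV [simp]: "measure S UNIV = 1" "measure P UNIV = 1"
  using S.prob_space P.prob_space by auto

lemma S_bounded_integrable:
  fixes f :: "real \<Rightarrow> real"
  assumes "f \<in> borel_measurable borel" "\<And>x. \<bar>f x\<bar> \<le> B"
  shows "integrable S f"
  by (rule S.integrable_const_bound[where B = B]) (use assms in auto)

lemma P_integrable: "integrable P (\<lambda>y. y)"
proof (rule Bochner_Integration.integrable_bound)
  show "integrable P (\<lambda>y. 1 + y\<^sup>2)" using P_square by simp
  have "norm y \<le> norm (1 + y\<^sup>2)" for y :: real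
  proof -
    have "0 \<le> (\<bar>y\<bar> - 1)\<^sup>2" by simp
    then show ?thesis by (simp add: power2_diff)
  qed
  then show "AE y in P. norm y \<le> norm (1 + y\<^sup>2)" by simp
qed simp

text \<open>The mixture identity also yields integrability: the left-hand side is finite and
  \<open>m\<close> is positive, so the double integral cannot be infinite.\<close>

lemma mixture_nonneg:
  fixes h :: "real \<Rightarrow> real"
  assumes [measurable]: "h \<in> borel_measurable borel" and h: "integrable S h" and nonneg: "\<And>x. 0 \<le> h x"
  shows "integrable (S \<Otimes>\<^sub>M P) (\<lambda>(s, y). h (s + y))"
    and "(m + 1) * (\<integral>s. h s \<partial>S) = h 0 + m * (\<integral>(s, y). h (s + y) \<partial>(S \<Otimes>\<^sub>M P))"
proof -
  let ?H = "\<lambda>z::real \<times> real. h (fst z + snd z)"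
  have eq: "(\<lambda>(s, y). h (s + y)) = ?H" by auto
  have "(\<integral>\<^sup>+s. \<integral>\<^sup>+y. ennreal (h (s + y)) \<partial>P \<partial>S) = (\<integral>\<^sup>+z. ennreal (?H z) \<partial>(S \<Otimes>\<^sub>M P))"
    using P.nn_integral_fst[of "\<lambda>z. ennreal (?H z)" S] by simp
  then have id: "ennreal ((m + 1) * (\<integral>s. h s \<partial>S))
      = ennreal (h 0) + ennreal m * (\<integral>\<^sup>+z. ennreal (?H z) \<partial>(S \<Otimes>\<^sub>M P))"
    using mixture[of "\<lambda>x. ennreal (h x)"] m_pos nonneg
    by (simp add: nn_integral_eq_integral[OF h] ennreal_mult integral_nonneg_AE)
  have fin: "(\<integral>\<^sup>+z. ennreal (?H z) \<partial>(S \<Otimes>\<^sub>M P)) < \<infinity>"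
  proof (rule ccontr)
    assume "\<not> ?thesis"
    then have "(\<integral>\<^sup>+z. ennreal (?H z) \<partial>(S \<Otimes>\<^sub>M P)) = \<top>" by (simp add: less_top[symmetric])
    with id m_pos show False by (simp add: ennreal_mult_top)
  qed
  have int: "integrable (S \<Otimes>\<^sub>M P) ?H"
    using fin nonneg by (intro integrableI_nonneg) auto
  then show "integrable (S \<Otimes>\<^sub>M P) (\<lambda>(s, y). h (s + y))" by (simp only: eq)
  have I0: "0 \<le> integral\<^sup>L (S \<Otimes>\<^sub>M P) ?H" using nonneg by (intro integral_nonneg_AE) auto
  have "ennreal ((m + 1) * (\<integral>s. h s \<partial>S)) = ennreal (h 0 + m * integral\<^sup>L (S \<Otimes>\<^sub>M P) ?H)"
    unfolding id using nn_integral_eq_integral[OF int] nonneg m_pos I0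
    by (simp add: ennreal_mult ennreal_plus)
  then show "(m + 1) * (\<integral>s. h s \<partial>S) = h 0 + m * (\<integral>(s, y). h (s + y) \<partial>(S \<Otimes>\<^sub>M P))"
    unfolding eq using m_pos nonneg I0
    by (subst (asm) ennreal_inj) (auto intro!: mult_nonneg_nonneg add_nonneg_nonneg integral_nonneg_AE)
qed

lemma mixture_real:
  fixes h :: "real \<Rightarrow> real"
  assumes [measurable]: "h \<in> borel_measurable borel" and h: "integrable S h"
  shows "integrable (S \<Otimes>\<^sub>M P) (\<lambda>(s, y). h (s + y))"
    and "(m + 1) * (\<integral>s. h s \<partial>S) = h 0 + m * (\<integral>(s, y). h (s + y) \<partial>(S \<Otimes>\<^sub>M P))"
proof -
  define p q where "p = (\<lambda>x. max (h x) 0)" and "q = (\<lambda>x. max (- h x) 0)"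
  have hpq: "h x = p x - q x" for x by (auto simp: p_def q_def)
  have pq: "p \<in> borel_measurable borel" "integrable S p" "\<And>x. 0 \<le> p x"
    "q \<in> borel_measurable borel" "integrable S q" "\<And>x. 0 \<le> q x"
    using h by (auto simp: p_def q_def)
  note P = mixture_nonneg[OF pq(1-3)] and Q = mixture_nonneg[OF pq(4-6)]
  have eq: "(\<lambda>(s, y). h (s + y)) = (\<lambda>z. (case z of (s, y) \<Rightarrow> p (s + y)) - (case z of (s, y) \<Rightarrow> q (s + y)))"
    by (auto simp: hpq)
  show "integrable (S \<Otimes>\<^sub>M P) (\<lambda>(s, y). h (s + y))"
    unfolding eq using P(1) Q(1) by (rule Bochner_Integration.integrable_diff)
  have "(\<integral>s. h s \<partial>S) = (\<integral>s. p s \<partial>S) - (\<integral>s. q s \<partial>S)"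
    unfolding hpq using pq by (intro Bochner_Integration.integral_diff) auto
  moreover have "(\<integral>(s, y). h (s + y) \<partial>(S \<Otimes>\<^sub>M P))
      = (\<integral>(s, y). p (s + y) \<partial>(S \<Otimes>\<^sub>M P)) - (\<integral>(s, y). q (s + y) \<partial>(S \<Otimes>\<^sub>M P))"
    unfolding eq using P(1) Q(1) by (rule Bochner_Integration.integral_diff)
  ultimately show "(m + 1) * (\<integral>s. h s \<partial>S) = h 0 + m * (\<integral>(s, y). h (s + y) \<partial>(S \<Otimes>\<^sub>M P))"
    using P(2) Q(2) hpq[of 0] by (simp add: right_diff_distrib)
qed

text \<open>The mixture identity is solved for the mean of \<open>h (s + y)\<close>; the linear term
  vanishes because \<open>P\<close> has mean 0 and the two coordinates are independent. It is
  applied to \<open>laplace_smooth\<close> and to a shifted \<open>huber\<close>.\<close>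

lemma taylor_mean:
  fixes h h' :: "real \<Rightarrow> real"
  assumes [measurable]: "h \<in> borel_measurable borel" and h: "integrable S h"
    and h': "h' \<in> borel_measurable borel" "\<And>x. \<bar>h' x\<bar> \<le> B"
  shows "integrable (S \<Otimes>\<^sub>M P) (\<lambda>(s, y). h (s + y) - h s - y * h' s)"
    and "m * (\<integral>(s, y). h (s + y) - h s - y * h' s \<partial>(S \<Otimes>\<^sub>M P)) = (\<integral>s. h s \<partial>S) - h 0"
proof -
  have h'': "integrable S h'" by (rule S_bounded_integrable[OF h'])
  note i = mixture_real(1)[OF assms(1) h] SP.integrable_fst_prob(1)[OF h]
    SP.integrable_mult_product(1)[OF h'' P_integrable]
  have eq: "(\<lambda>(s, y). h (s + y) - h s - y * h' s) =
    (\<lambda>z. (case z of (s, y) \<Rightarrow> h (s + y)) - (case z of (s, y) \<Rightarrow> h s) - (case z of (s, y) \<Rightarrow> h' s * y))"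
    by (auto simp: mult.commute)
  show "integrable (S \<Otimes>\<^sub>M P) (\<lambda>(s, y). h (s + y) - h s - y * h' s)"
    unfolding eq using i by (intro Bochner_Integration.integrable_diff)
  have E: "(\<integral>(s, y). h (s + y) - h s - y * h' s \<partial>(S \<Otimes>\<^sub>M P))
     = (\<integral>(s, y). h (s + y) \<partial>(S \<Otimes>\<^sub>M P)) - (\<integral>s. h s \<partial>S)"
    unfolding eq Bochner_Integration.integral_diff[OF Bochner_Integration.integrable_diff[OF i(1,2)] i(3)]
      Bochner_Integration.integral_diff[OF i(1,2)]
      SP.integrable_mult_product(2)[OF h'' P_integrable] SP.integrable_fst_prob(2)[OF h]
    by (simp add: P_mean)
  show "m * (\<integral>(s, y). h (s + y) - h s - y * h' s \<partial>(S \<Otimes>\<^sub>M P)) = (\<integral>s. h s \<partial>S) - h 0"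
    unfolding E using mixture_real(2)[OF assms(1) h] by (simp add: algebra_simps)
qed

end

section \<open>Huber functions\<close>

definition clamp_at :: "real \<Rightarrow> real \<Rightarrow> real" where
  "clamp_at R x = max (- R) (min R x)"

text \<open>For \<open>R \<ge> 0\<close> it is quadratic on \<open>{-R..R}\<close>, continued
  linearly with slopes \<open>-R\<close> and \<open>R\<close>; \<open>clamp_at R\<close> is its
  derivative.\<close>

definition huber :: "real \<Rightarrow> real \<Rightarrow> real" where
  "huber R x = clamp_at R x * x - (clamp_at R x)\<^sup>2 / 2"

lemma huber_measurable [measurable]:
  "clamp_at R \<in> borel_measurable borel" "huber R \<in> borel_measurable borel"
  unfolding huber_def[abs_def] clamp_at_def[abs_def] by measurable

lemma clamp_at_bound: "0 \<le> R \<Longrightarrow> \<bar>clamp_at R x\<bar> \<le> R"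
  by (auto simp: clamp_at_def)

lemma huber_quadratic: "\<bar>x\<bar> \<le> R \<Longrightarrow> huber R x = x\<^sup>2 / 2" "\<bar>x\<bar> \<le> R \<Longrightarrow> clamp_at R x = x"
  by (auto simp: huber_def clamp_at_def power2_eq_square)

text \<open>\<open>huber R\<close> is the convex conjugate of \<open>p\<^sup>2 / 2\<close> restricted to \<open>{-R..R}\<close>, which gives its
  convexity without derivatives.\<close>

lemma huber_ge:
  assumes "\<bar>p\<bar> \<le> R"
  shows "p * x - p\<^sup>2 / 2 \<le> huber R x"
proof -
  define c where "c = clamp_at R x"
  have "0 \<le> (c - p) * (x - (c + p) / 2)"
  proof -
    consider "x \<le> - R" "c = - R" | "- R \<le> x" "x \<le> R" "c = x" | "R \<le> x" "c = R"
      using assms by (force simp: c_def clamp_at_def)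
    then show ?thesis
    proof cases
      case 1 then show ?thesis using assms by (intro mult_nonpos_nonpos) (auto simp: field_simps)
    next
      case 2
      then have "(c - p)\<^sup>2 / 2 = (c - p) * (x - (c + p) / 2)" by (simp add: power2_eq_square field_simps)
      moreover have "0 \<le> (c - p)\<^sup>2 / 2" by simp
      ultimately show ?thesis by (simp only:)
    next
      case 3 then show ?thesis using assms by (intro mult_nonneg_nonneg) (auto simp: field_simps)
    qed
  qed
  also have "(c - p) * (x - (c + p) / 2) = (c * x - c\<^sup>2 / 2) - (p * x - p\<^sup>2 / 2)"
    by (simp add: power2_eq_square field_simps)
  finally show ?thesis by (simp add: huber_def c_def)
qed

text \<open>\<open>huber_ge\<close> at the point \<open>x + y\<close>, with the slope at
  \<open>x\<close> as \<open>p\<close>. It makes the first order Taylor remainder of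
  \<open>huber\<close> nonnegative.\<close>

lemma huber_tangent:
  assumes "0 \<le> R"
  shows "huber R x + y * clamp_at R x \<le> huber R (x + y)"
  using huber_ge[OF clamp_at_bound[OF assms], of x "x + y"] by (simp add: huber_def algebra_simps)

lemma huber_lipschitz:
  assumes "0 \<le> R"
  shows "\<bar>huber R x - huber R y\<bar> \<le> R * \<bar>x - y\<bar>"
proof -
  have *: "huber R x - huber R y \<le> R * \<bar>x - y\<bar>" for x y
  proof -
    have "huber R x - huber R y \<le> clamp_at R x * (x - y)"
      using huber_tangent[OF assms, of x "y - x"] by (simp add: algebra_simps)
    also have "\<dots> \<le> \<bar>clamp_at R x\<bar> * \<bar>x - y\<bar>" by (metis abs_ge_self abs_mult)
    also have "\<dots> \<le> R * \<bar>x - y\<bar>" by (intro mult_right_mono clamp_at_bound assms) simp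
    finally show ?thesis .
  qed
  show ?thesis using *[of x y] *[of y x] by (simp add: abs_minus_commute abs_le_iff)
qed

section \<open>Concentration of the geometric sum\<close>

context geometric_law
begin

lemma S_abs: "integrable S (\<lambda>s. \<bar>s\<bar>)" "(\<integral>s. \<bar>s\<bar> \<partial>S) \<le> 1"
proof -
  have le: "\<bar>s\<bar> \<le> (1 + s\<^sup>2) / 2" for s :: real
  proof -
    have "0 \<le> (\<bar>s\<bar> - 1)\<^sup>2" by simp
    then show ?thesis by (simp add: power2_diff)
  qed
  have i: "integrable S (\<lambda>s. (1 + s\<^sup>2) / 2)" using S_square by simp
  show j: "integrable S (\<lambda>s. \<bar>s\<bar>)"
    by (rule Bochner_Integration.integrable_bound[OF i]) (use le in \<open>auto intro!: AE_I2\<close>)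
  have "(\<integral>s. \<bar>s\<bar> \<partial>S) \<le> (\<integral>s. (1 + s\<^sup>2) / 2 \<partial>S)"
    by (rule integral_mono[OF j i le])
  also have "\<dots> = 1" using S_square by (simp add: S_var S.prob_space)
  finally show "(\<integral>s. \<bar>s\<bar> \<partial>S) \<le> 1" .
qed

text \<open>\<open>taylor_mean\<close> for a Huber function: its first order remainder is
  \<open>y\<^sup>2 / 2\<close> when \<open>s\<close> lies in the interval and \<open>y\<close> in
  \<open>{-w..w}\<close>, and nonnegative otherwise. Its total is \<open>E h(S) - h(0)\<close>, at
  most \<open>R * E |S|\<close>, hence at most \<open>R\<close>; with \<open>half\<close> this
  bounds the probability by \<open>4 * R\<close>.\<close>

lemma S_interval_le:
  assumes w: "0 \<le> w" and u: "0 \<le> u"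
    and half: "1 / 2 \<le> m * (\<integral>y. y\<^sup>2 * indicator {-w..w} y \<partial>P)"
  shows "measure S {c..c+u} \<le> 2 * (u + 2 * w)"
proof -
  \<comment> \<open>The quadratic zone is the interval \<open>{c..c+u}\<close> enlarged by
    \<open>w\<close> on both sides, so it contains both \<open>s\<close> and
    \<open>s + y\<close>.\<close>
  define R c0 where "R = u / 2 + w" and "c0 = c + u / 2"
  have R: "0 \<le> R" using w u by (simp add: R_def)
  define h h' where "h = (\<lambda>s. huber R (s - c0))" and "h' = (\<lambda>s. clamp_at R (s - c0))"
  have mh [measurable]: "h \<in> borel_measurable borel" and mh' [measurable]: "h' \<in> borel_measurable borel"
    unfolding h_def h'_def by measurable
  have lip: "\<bar>h s - h 0\<bar> \<le> R * \<bar>s\<bar>" for s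
    unfolding h_def using huber_lipschitz[OF R, of "s - c0" "0 - c0"] by simp
  have dh: "integrable S (\<lambda>s. h s - h 0)"
    by (rule Bochner_Integration.integrable_bound[where f = "\<lambda>s. R * \<bar>s\<bar>"])
       (use lip R in \<open>auto intro!: AE_I2 S_abs\<close>)
  have h: "integrable S h"
    using Bochner_Integration.integrable_add[OF dh, of "\<lambda>_. h 0"] by simp
  have h': "\<bar>h' s\<bar> \<le> R" for s unfolding h'_def by (rule clamp_at_bound[OF R])
  note T = taylor_mean[OF mh h mh' h']
  have I: "integrable S (indicator {c..c+u} :: real \<Rightarrow> real)"
    by (rule S_bounded_integrable[where B = 1]) (auto simp: indicator_def)
  have J: "integrable P (\<lambda>y. y\<^sup>2 * indicator {-w..w} y)"
    by (rule Bochner_Integration.integrable_bound[OF P_square]) (auto intro!: AE_I2 simp: indicator_def)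
  have "measure S {c..c+u} * (1/2) \<le> measure S {c..c+u} * (m * (\<integral>y. y\<^sup>2 * indicator {-w..w} y \<partial>P))"
    by (intro mult_left_mono half) simp
  also have "\<dots> = 2 * (m * (\<integral>(s, y). indicator {c..c+u} s * (y\<^sup>2 * indicator {-w..w} y / 2) \<partial>(S \<Otimes>\<^sub>M P)))"
    using SP.integrable_mult_product(2)[OF I, of "\<lambda>y. y\<^sup>2 * indicator {-w..w} y / 2"] J by simp
  also have "\<dots> \<le> 2 * (m * (\<integral>(s, y). h (s + y) - h s - y * h' s \<partial>(S \<Otimes>\<^sub>M P)))"
  proof (intro mult_left_mono integral_mono)
    show "integrable (S \<Otimes>\<^sub>M P) (\<lambda>(s, y). indicator {c..c+u} s * (y\<^sup>2 * indicator {-w..w} y / 2))"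
      by (intro SP.integrable_mult_product I Bochner_Integration.integrable_divide J)
    show "integrable (S \<Otimes>\<^sub>M P) (\<lambda>(s, y). h (s + y) - h s - y * h' s)"
      by (rule T(1))
    fix z :: "real \<times> real"
    obtain s y where z: "z = (s, y)" by (cases z)
    have "indicator {c..c+u} s * (y\<^sup>2 * indicator {-w..w} y / 2) \<le> h (s + y) - h s - y * h' s"
    proof (cases "s \<in> {c..c+u} \<and> y \<in> {-w..w}")
      case True
      then have "\<bar>s - c0\<bar> \<le> R" "\<bar>s + y - c0\<bar> \<le> R"
        unfolding R_def c0_def by (auto simp: abs_le_iff field_simps)
      then have "h (s + y) - h s - y * h' s = y\<^sup>2 / 2"
        unfolding h_def h'_def by (simp add: huber_quadratic) (simp add: power2_eq_square field_simps)
      then show ?thesis using True by simp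
    next
      case False
      have "0 \<le> h (s + y) - h s - y * h' s"
        using huber_tangent[OF R, of "s - c0" y] unfolding h_def h'_def by (simp add: algebra_simps)
      then show ?thesis using False by (auto simp: indicator_def)
    qed
    then show "(case z of (s, y) \<Rightarrow> indicator {c..c+u} s * (y\<^sup>2 * indicator {-w..w} y / 2))
        \<le> (case z of (s, y) \<Rightarrow> h (s + y) - h s - y * h' s)" by (simp add: z)
  qed (use m_pos in auto)
  also have "\<dots> = 2 * (\<integral>s. h s - h 0 \<partial>S)"
    unfolding T(2) using h by (simp add: S.prob_space)
  also have "\<dots> \<le> 2 * (\<integral>s. R * \<bar>s\<bar> \<partial>S)"
    using lip S_abs(1) by (intro mult_left_mono integral_mono[OF dh]) (auto simp: abs_le_iff)
  also have "\<dots> \<le> 2 * (R * 1)"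
    using S_abs(2) R by (simp add: mult_left_le)
  finally show ?thesis by (simp add: R_def)
qed

text \<open>A shift by \<open>u\<close> moves a point across an interval only near one of the two end points.\<close>

lemma S_shift_interval:
  assumes q: "\<And>c. measure S {c..c+\<bar>u\<bar>} \<le> q"
  shows "\<bar>\<integral>s. indicator {a..b} (s + u) - indicator {a..b} s \<partial>S\<bar> \<le> q"
proof -
  have bi: "integrable S (indicator A :: real \<Rightarrow> real)" if "A \<in> sets borel" for A
    by (rule S_bounded_integrable[where B = 1]) (use that in \<open>auto simp: indicator_def\<close>)
  have d: "integrable S (\<lambda>s. indicator {a..b} (s + u) - indicator {a..b} s :: real)"
    by (rule S_bounded_integrable[where B = 1]) (auto simp: indicator_def)
  \<comment> \<open>The interval starting at \<open>c1\<close> catches the points shifted into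
    \<open>{a..b}\<close>, the one starting at \<open>c2\<close> those shifted out; the sign of
    \<open>u\<close> decides which end point is involved.\<close>
  define c1 c2 where "c1 = (if 0 \<le> u then a - u else b)" and "c2 = (if 0 \<le> u then b - u else a)"
  have "(\<integral>s. indicator {a..b} (s + u) - indicator {a..b} s \<partial>S) \<le> (\<integral>s. (indicator {c1..c1+\<bar>u\<bar>} s :: real) \<partial>S)"
    by (rule integral_mono[OF d bi]) (auto simp: c1_def indicator_def)
  moreover have "(\<integral>s. (- indicator {c2..c2+\<bar>u\<bar>} s :: real) \<partial>S) \<le> (\<integral>s. indicator {a..b} (s + u) - indicator {a..b} s \<partial>S)"
    by (rule integral_mono[OF Bochner_Integration.integrable_minus[OF bi] d]) (auto simp: c2_def indicator_def)
  ultimately show ?thesis using q[of c1] q[of c2] by (simp add: abs_le_iff)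
qed

end

section \<open>Approximation by the Laplace distribution\<close>

text \<open>Replacing the minimum by 1 gives 2 * 1/2, replacing it by \<open>c * v\<close> gives
  \<open>2 * c / 6\<close>.\<close>

lemma integral_min_linear_le:
  fixes c :: real
  assumes "0 \<le> c"
  shows "set_integrable lborel {0..1} (\<lambda>v. (1 - v) * (2 * min 1 (c * v)))"
    and "(LBINT v:{0..1}. (1 - v) * (2 * min 1 (c * v))) \<le> min 1 (c / 3)"
proof -
  let ?f = "\<lambda>v::real. (1 - v) * (2 * min 1 (c * v))"
  show i: "set_integrable lborel {0..1} ?f"
    by (intro borel_integrable_atLeastAtMost' continuous_intros)
  have f: "(?f has_integral (LBINT v:{0..1}. ?f v)) {0..1}"
    using set_borel_integral_eq_integral[OF i] by (simp add: has_integral_iff)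
  have "((\<lambda>v::real. (1 - v) * 2) has_integral 1/2 * 2) {0..1}"
    by (intro has_integral_mult_left integral_one_minus)
  then have "(LBINT v:{0..1}. ?f v) \<le> 1/2 * 2"
  proof (rule has_integral_le[OF f])
    show "?f v \<le> (1 - v) * 2" if "v \<in> {0..1}" for v
      using that by (intro mult_left_mono) auto
  qed
  moreover have "((\<lambda>v::real. (1 - v) * v * (2 * c)) has_integral 1/6 * (2 * c)) {0..1}"
    by (intro has_integral_mult_left integral_one_minus_mult)
  then have "(LBINT v:{0..1}. ?f v) \<le> 1/6 * (2 * c)"
  proof (rule has_integral_le[OF f])
    show "?f v \<le> (1 - v) * v * (2 * c)" if "v \<in> {0..1}" for v
    proof -
      have "(1 - v) * (2 * min 1 (c * v)) \<le> (1 - v) * (2 * (c * v))"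
        using that by (intro mult_left_mono) auto
      then show ?thesis by (simp add: mult_ac)
    qed
  qed
  ultimately show "(LBINT v:{0..1}. ?f v) \<le> min 1 (c / 3)" by simp
qed

context geometric_law
begin

text \<open>By its definition \<open>laplace_smooth2\<close> splits into a smooth part, which is
  Lipschitz pointwise, and an indicator, whose increment is small only on average, through the
  concentration of \<open>S\<close>.\<close>

lemma S_shift_smooth2:
  assumes ab: "a \<le> b" and w: "0 \<le> w" and v: "0 \<le> v"
    and conc: "\<And>u c. 0 \<le> u \<Longrightarrow> measure S {c..c+u} \<le> 2 * (u + 2 * w)"
  shows "\<bar>\<integral>s. laplace_smooth2 a b (s + v * y) - laplace_smooth2 a b s \<partial>S\<bar>
    \<le> 2 * min 1 (sqrt 2 * \<bar>y\<bar> / 2 * v) + (8 * w + 2 * min 1 (2 * \<bar>y\<bar> * v))"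
proof -
  let ?h = "laplace_smooth a b" and ?t = "v * y"
  define u where y: "u = v * \<bar>y\<bar>"
  have u: "0 \<le> u" using v by (simp add: y)
  have ut: "\<bar>?t\<bar> = u" using v y by (simp add: abs_mult)
  have hi: "integrable S ?h" "integrable S (\<lambda>s. ?h (s + ?t))"
    using laplace_smooth_bounds[OF ab] by (auto intro!: S_bounded_integrable[where B = 1])
  have ii: "integrable S (\<lambda>s. indicator {a..b} (s + ?t) - indicator {a..b} s :: real)"
    by (rule S_bounded_integrable[where B = 1]) (auto simp: indicator_def)
  have "\<bar>\<integral>s. ?h (s + ?t) - ?h s \<partial>S\<bar> \<le> (\<integral>s. min 1 (sqrt 2 * u / 2) \<partial>S)"
  proof (rule integral_abs_bound_integral)
    show "\<bar>?h (s + ?t) - ?h s\<bar> \<le> min 1 (sqrt 2 * u / 2)" for s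
      using laplace_smooth_lipschitz[of a b "s + ?t" s] by (simp add: ut)
  qed (use hi in auto)
  then have 1: "\<bar>\<integral>s. ?h (s + ?t) - ?h s \<partial>S\<bar> \<le> min 1 (sqrt 2 * \<bar>y\<bar> / 2 * v)"
    by (simp add: y mult_ac)
  have 2: "\<bar>\<integral>s. indicator {a..b} (s + ?t) - indicator {a..b} s \<partial>S\<bar> \<le> 4 * w + min 1 (2 * \<bar>y\<bar> * v)"
  proof (rule S_shift_interval)
    fix c
    \<comment> \<open>Only the part growing with \<open>u\<close> is capped at 1, so that
      \<open>integral_min_linear_le\<close> applies to it while \<open>4 * w\<close> stays a
      constant.\<close>
    have "measure S {c..c+u} \<le> 4 * w + 2 * u" using conc[OF u, of c] by (simp add: distrib_left)
    moreover have "measure S {c..c+u} \<le> 4 * w + 1" using S.prob_le_1[of "{c..c+u}"] w by linarith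
    ultimately have "measure S {c..c+u} \<le> 4 * w + min 1 (2 * u)" by (simp add: min_def)
    then show "measure S {c..c + \<bar>?t\<bar>} \<le> 4 * w + min 1 (2 * \<bar>y\<bar> * v)"
      unfolding ut by (simp add: y mult_ac)
  qed
  have "(\<integral>s. laplace_smooth2 a b (s + ?t) - laplace_smooth2 a b s \<partial>S)
     = (\<integral>s. 2 * (?h (s + ?t) - ?h s) - 2 * (indicator {a..b} (s + ?t) - indicator {a..b} s) \<partial>S)"
    by (simp add: laplace_smooth2_def algebra_simps)
  also have "\<dots> = 2 * (\<integral>s. ?h (s + ?t) - ?h s \<partial>S)
      - 2 * (\<integral>s. indicator {a..b} (s + ?t) - indicator {a..b} s \<partial>S)"
  proof -
    have "integrable S (\<lambda>s. 2 * (?h (s + ?t) - ?h s))"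
      by (intro integrable_mult_right Bochner_Integration.integrable_diff hi)
    moreover have "integrable S (\<lambda>s. 2 * (indicator {a..b} (s + ?t) - indicator {a..b} s :: real))"
      by (intro integrable_mult_right ii)
    ultimately show ?thesis
      by (simp only: Bochner_Integration.integral_diff integral_mult_right_zero)
  qed
  finally show ?thesis using 1 2 by linarith
qed

text \<open>Fubini moves the mean over \<open>S\<close> inside the integral over \<open>v\<close>,
  where \<open>S_shift_smooth2\<close> applies. Integration against \<open>1 - v\<close> turns
  \<open>8 * w\<close> into \<open>4 * w\<close> and the slopes
  \<open>sqrt 2 * \<bar>y\<bar> / 2\<close> and \<open>2 * \<bar>y\<bar>\<close> into a third of
  themselves.\<close>

lemma remainder_mean_le:
  assumes ab: "a \<le> b" and w: "0 \<le> w"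
    and conc: "\<And>u c. 0 \<le> u \<Longrightarrow> measure S {c..c+u} \<le> 2 * (u + 2 * w)"
  shows "\<bar>\<integral>s. laplace_smooth a b (s + y) - laplace_smooth a b s - y * laplace_smooth1 a b s
           - y\<^sup>2 / 2 * laplace_smooth2 a b s \<partial>S\<bar>
       \<le> y\<^sup>2 * (4 * w + (min 1 (sqrt 2 * \<bar>y\<bar> / 6) + min 1 (2 * \<bar>y\<bar> / 3)))"
proof -
  interpret L: pair_sigma_finite S lborel ..
  let ?k = "laplace_smooth2 a b"
  let ?f = "\<lambda>s v. indicator {0..1} v *\<^sub>R ((1 - v) * (?k (s + v * y) - ?k s))"
  define D where "D v = (\<integral>s. ?k (s + v * y) - ?k s \<partial>S)" for v
  let ?g = "\<lambda>v. (1 - v) * (2 * min 1 (sqrt 2 * \<bar>y\<bar> / 2 * v)) + ((1 - v) * (8 * w)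
      + (1 - v) * (2 * min 1 (2 * \<bar>y\<bar> * v)))"
  have int: "integrable (S \<Otimes>\<^sub>M lborel) (case_prod ?f)"
  \<comment> \<open>Fubini is justified by the bound 4 = 2 + 2 on a strip of finite measure.\<close>
  proof (rule integrableI_bounded_set[where A = "UNIV \<times> {0..1::real}" and B = 4])
    show "UNIV \<times> {0..1::real} \<in> sets (S \<Otimes>\<^sub>M lborel)" by (intro pair_measureI) auto
    show "emeasure (S \<Otimes>\<^sub>M lborel) (UNIV \<times> {0..1::real}) < \<infinity>"
      by (subst lborel.emeasure_pair_measure_Times) (auto simp: S.emeasure_space_1[simplified])
    have "norm (?f s v) \<le> 4" for s v
    proof (cases "v \<in> {0..1}")
      case True
      have "\<bar>?k (s + v * y) - ?k s\<bar> \<le> 4"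
        using laplace_smooth2_bound[OF ab, of "s + v * y"] laplace_smooth2_bound[OF ab, of s] by linarith
      then have "\<bar>1 - v\<bar> * \<bar>?k (s + v * y) - ?k s\<bar> \<le> 1 * 4"
        using True by (intro mult_mono) auto
      then show ?thesis using True by (simp add: abs_mult)
    qed auto
    then show "AE z in S \<Otimes>\<^sub>M lborel. z \<in> UNIV \<times> {0..1::real} \<longrightarrow> norm (case_prod ?f z) \<le> 4"
      by (auto intro!: AE_I2)
    show "AE z in S \<Otimes>\<^sub>M lborel. z \<notin> UNIV \<times> {0..1::real} \<longrightarrow> case_prod ?f z = 0"
      by (auto intro!: AE_I2 simp: indicator_def)
  qed measurable
  have inner: "(\<integral>s. ?f s v \<partial>S) = indicator {0..1} v * ((1 - v) * D v)" for v
    by (simp add: D_def)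
  have "(\<integral>s. laplace_smooth a b (s + y) - laplace_smooth a b s - y * laplace_smooth1 a b s
           - y\<^sup>2 / 2 * ?k s \<partial>S) = y\<^sup>2 * (\<integral>s. (\<integral>v. ?f s v \<partial>lborel) \<partial>S)"
    by (simp only: laplace_smooth_taylor[OF ab] set_lebesgue_integral_def integral_mult_right_zero)
  also have "\<dots> = y\<^sup>2 * (\<integral>v. indicator {0..1} v * ((1 - v) * D v) \<partial>lborel)"
    by (simp only: L.Fubini_integral[OF int, symmetric] inner)
  finally have eq: "(\<integral>s. laplace_smooth a b (s + y) - laplace_smooth a b s - y * laplace_smooth1 a b s
           - y\<^sup>2 / 2 * ?k s \<partial>S) = y\<^sup>2 * (\<integral>v. indicator {0..1} v * ((1 - v) * D v) \<partial>lborel)" .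
  have c: "set_integrable lborel {0..1} (\<lambda>v. (1 - v) * (8 * w))"
    by (intro borel_integrable_atLeastAtMost' continuous_intros)
  have ci: "(LBINT v:{0..1}. (1 - v) * (8 * w)) = 4 * w"
    unfolding set_borel_integral_eq_integral(2)[OF c]
    using has_integral_mult_left[OF integral_one_minus, of "8 * w"] by (intro integral_unique) simp
  have "0 \<le> sqrt 2 * \<bar>y\<bar> / 2" "0 \<le> 2 * \<bar>y\<bar>" by auto
  note g1 = integral_min_linear_le[OF this(1)] and g2 = integral_min_linear_le[OF this(2)]
  have g: "set_integrable lborel {0..1} ?g"
    by (intro set_integral_add c g1(1) g2(1))
  have "\<bar>\<integral>v. indicator {0..1} v * ((1 - v) * D v) \<partial>lborel\<bar> \<le> (LBINT v:{0..1}. ?g v)"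
    unfolding set_lebesgue_integral_def
  proof (rule integral_abs_bound_integral)
    show "integrable lborel (\<lambda>v. indicator {0..1} v * ((1 - v) * D v))"
      using L.integrable_snd[OF int] by (simp only: inner)
    show "integrable lborel (\<lambda>v. indicator {0..1} v *\<^sub>R ?g v)"
      using g by (simp add: set_integrable_def)
    show "\<bar>indicator {0..1} v * ((1 - v) * D v)\<bar> \<le> indicator {0..1} v *\<^sub>R ?g v" for v
    proof (cases "v \<in> {0..1}")
      case True
      then have "\<bar>D v\<bar> \<le> 2 * min 1 (sqrt 2 * \<bar>y\<bar> / 2 * v) + (8 * w + 2 * min 1 (2 * \<bar>y\<bar> * v))"
        unfolding D_def by (intro S_shift_smooth2[OF ab w _ conc]) auto
      from mult_left_mono[OF this, of "1 - v"] have "(1 - v) * \<bar>D v\<bar> \<le> ?g v"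
        using True by (simp only: distrib_left) simp
      then show ?thesis using True by (simp add: abs_mult)
    qed auto
  qed
  also have "\<dots> = (LBINT v:{0..1}. (1 - v) * (2 * min 1 (sqrt 2 * \<bar>y\<bar> / 2 * v)))
      + (4 * w + (LBINT v:{0..1}. (1 - v) * (2 * min 1 (2 * \<bar>y\<bar> * v))))"
    unfolding ci[symmetric]
    by (simp only: set_integral_add(2)[OF g1(1) set_integral_add(1)[OF c g2(1)]] set_integral_add(2)[OF c g2(1)])
  also have "\<dots> \<le> 4 * w + (min 1 (sqrt 2 * \<bar>y\<bar> / 6) + min 1 (2 * \<bar>y\<bar> / 3))"
  proof -
    have "sqrt 2 * \<bar>y\<bar> / 2 / 3 = sqrt 2 * \<bar>y\<bar> / 6" by simp
    note add_mono[OF g1(2)[unfolded this] g2(2)]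
    then show ?thesis by (subst add.left_commute) (rule add_left_mono)
  qed
  finally show ?thesis
    unfolding eq abs_mult by (simp add: mult_left_mono)
qed

text \<open>The first order terms contribute \<open>E h(S) - h(0)\<close>. Because
  \<open>m * E Y^2 = 1\<close>, the second order term contributes half the mean of
  \<open>h''(S)\<close>, that is \<open>E h(S) - P(a \<le> S \<le> b)\<close>. Their difference is
  the left-hand side, since \<open>h(0)\<close> is the Laplace probability.\<close>

lemma S_interval_laplace:
  assumes ab: "a \<le> b" and w: "0 \<le> w"
    and conc: "\<And>u c. 0 \<le> u \<Longrightarrow> measure S {c..c+u} \<le> 2 * (u + 2 * w)"
  shows "\<bar>measure S {a..b} - (laplace_cdf b - laplace_cdf a)\<bar>
    \<le> 4 * w + m * (\<integral>y. y\<^sup>2 * (min 1 (sqrt 2 * \<bar>y\<bar> / 6) + min 1 (2 * \<bar>y\<bar> / 3)) \<partial>P)"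
proof -
  let ?h = "laplace_smooth a b" and ?h' = "laplace_smooth1 a b" and ?k = "laplace_smooth2 a b"
  let ?r = "\<lambda>s y. ?h (s + y) - ?h s - y * ?h' s - y\<^sup>2 / 2 * ?k s"
  let ?\<beta> = "\<lambda>y. min 1 (sqrt 2 * \<bar>y\<bar> / 6) + min 1 (2 * \<bar>y\<bar> / 3)"
  have h: "integrable S ?h" and k: "integrable S ?k"
    using laplace_smooth_bounds[OF ab] laplace_smooth2_bound[OF ab]
    by (auto intro: S_bounded_integrable[where B = 1] S_bounded_integrable[where B = 2])
  have I: "integrable S (indicator {a..b} :: real \<Rightarrow> real)"
    by (rule S_bounded_integrable[where B = 1]) (auto simp: indicator_def)
  note T = taylor_mean[OF laplace_smooth_measurable(1) h laplace_smooth_measurable(2) laplace_smooth1_bound]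
  have sq: "integrable P (\<lambda>y. y\<^sup>2 / 2)" using P_square by simp
  note K = SP.integrable_mult_product[OF k sq]
  have r: "case_prod ?r = (\<lambda>z. (case z of (s, y) \<Rightarrow> ?h (s + y) - ?h s - y * ?h' s)
      - (case z of (s, y) \<Rightarrow> ?k s * (y\<^sup>2 / 2)))"
    by (auto simp: mult.commute)
  have ri: "integrable (S \<Otimes>\<^sub>M P) (case_prod ?r)"
    unfolding r by (rule Bochner_Integration.integrable_diff[OF T(1) K(1)])
  have "(\<integral>s. ?k s \<partial>S) = 2 * ((\<integral>s. ?h s \<partial>S) - measure S {a..b})"
    unfolding laplace_smooth2_def using h I by simp
  moreover have h0: "?h 0 = laplace_cdf b - laplace_cdf a" by (simp add: laplace_smooth_def)
  moreover have "m * integral\<^sup>L (S \<Otimes>\<^sub>M P) (case_prod ?r)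
     = m * (\<integral>(s, y). ?h (s + y) - ?h s - y * ?h' s \<partial>(S \<Otimes>\<^sub>M P)) - (\<integral>s. ?k s \<partial>S) * (m * (\<integral>y. y\<^sup>2 \<partial>P)) / 2"
    unfolding r Bochner_Integration.integral_diff[OF T(1) K(1)] K(2) by (simp add: algebra_simps)
  ultimately have eq: "measure S {a..b} - (laplace_cdf b - laplace_cdf a)
      = m * (\<integral>y. (\<integral>s. ?r s y \<partial>S) \<partial>P)"
    unfolding SP.integral_snd[OF ri] T(2) P_var h0 by (simp add: field_simps)
  have bi: "integrable P (\<lambda>y. y\<^sup>2 * ?\<beta> y)"
    by (rule Bochner_Integration.integrable_bound[where f = "\<lambda>y. y\<^sup>2 * 2"])
       (auto intro!: P_square AE_I2 mult_left_mono simp: abs_mult)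
  have "\<bar>\<integral>y. (\<integral>s. ?r s y \<partial>S) \<partial>P\<bar> \<le> (\<integral>y. y\<^sup>2 * (4 * w + ?\<beta> y) \<partial>P)"
  proof (rule integral_abs_bound_integral)
    show "integrable P (\<lambda>y. \<integral>s. ?r s y \<partial>S)" by (rule SP.integrable_snd[OF ri])
    show "integrable P (\<lambda>y. y\<^sup>2 * (4 * w + ?\<beta> y))"
      unfolding distrib_left by (intro Bochner_Integration.integrable_add integrable_mult_left P_square bi[unfolded distrib_left])
  qed (rule remainder_mean_le[OF ab w conc])
  also have "\<dots> = (\<integral>y. y\<^sup>2 * (4 * w) + y\<^sup>2 * ?\<beta> y \<partial>P)" by (simp only: distrib_left)
  also have "\<dots> = (\<integral>y. y\<^sup>2 \<partial>P) * (4 * w) + (\<integral>y. y\<^sup>2 * ?\<beta> y \<partial>P)"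
    by (subst Bochner_Integration.integral_add[OF _ bi]) (simp_all add: P_square)
  finally have "m * \<bar>\<integral>y. (\<integral>s. ?r s y \<partial>S) \<partial>P\<bar>
      \<le> m * ((\<integral>y. y\<^sup>2 \<partial>P) * (4 * w) + (\<integral>y. y\<^sup>2 * ?\<beta> y \<partial>P))"
    using m_pos by (intro mult_left_mono) auto
  also have "\<dots> = (m * (\<integral>y. y\<^sup>2 \<partial>P)) * (4 * w) + m * (\<integral>y. y\<^sup>2 * ?\<beta> y \<partial>P)"
    by (simp add: algebra_simps)
  finally show ?thesis unfolding eq P_var abs_mult using m_pos by simp
qed

lemma S_interval_gamma_weight:
  assumes ab: "a \<le> b"
    and d: "d = m * (\<integral>y. y\<^sup>2 * gamma_weight y \<partial>P)" "d \<le> 0.1348"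
  shows "\<bar>measure S {a..b} - (laplace_cdf b - laplace_cdf a)\<bar> \<le> 7.4 * d"
proof -
  have gi: "integrable P (\<lambda>y. y\<^sup>2 * gamma_weight y)"
    by (rule Bochner_Integration.integrable_bound[where f = "\<lambda>y. y\<^sup>2 * 2"])
       (auto intro!: P_square AE_I2 mult_left_mono gamma_weight_le_2 simp: abs_mult gamma_weight_nonneg)
  have nn: "0 \<le> (\<integral>y. y\<^sup>2 * gamma_weight y \<partial>P)"
    by (intro integral_nonneg_AE AE_I2 mult_nonneg_nonneg gamma_weight_nonneg) simp
  \<comment> \<open>Positivity is used below to cancel \<open>d\<close>. It holds because the weight
    vanishes only at 0, whereas \<open>P\<close> has positive variance.\<close>
  have d0: "0 < d"
  proof (rule ccontr)
    assume "\<not> 0 < d"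
    then have "(\<integral>y. y\<^sup>2 * gamma_weight y \<partial>P) = 0"
      using d nn m_pos by (simp add: zero_less_mult_iff)
    then have "AE y in P. y\<^sup>2 * gamma_weight y = 0"
      using integral_nonneg_eq_0_iff_AE[OF gi] by (simp add: gamma_weight_nonneg)
    then have "AE y in P. y\<^sup>2 = 0"
    proof eventually_elim
      case (elim y)
      have "y = 0" if "gamma_weight y = 0"
        using gamma_weight_ge_rational[of y] that
        by (simp add: divide_le_0_iff add_nonneg_eq_0_iff) (smt (verit) zero_le_power2)
      then show ?case using elim by auto
    qed
    then have "(\<integral>y. y\<^sup>2 \<partial>P) = 0" by (rule integral_eq_zero_AE)
    then show False using P_var by simp
  qed
  define w where "w = 1.3 * d"
  have w: "0 \<le> w" using d0 by (simp add: w_def)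
  have J: "integrable P (\<lambda>y. y\<^sup>2 * indicator {-w..w} y)"
    by (rule Bochner_Integration.integrable_bound[OF P_square]) (auto intro!: AE_I2 simp: indicator_def)
  \<comment> \<open>Markov argument: the weight is at least \<open>2 * d\<close> outside
    \<open>{-w..w}\<close>, so \<open>2 * d\<close> times the normalised second moment there is at
    most \<open>d\<close>.\<close>
  have half: "1 / 2 \<le> m * (\<integral>y. y\<^sup>2 * indicator {-w..w} y \<partial>P)"
  proof -
    have "(\<integral>y. 2 * d * (y\<^sup>2 - y\<^sup>2 * indicator {-w..w} y) \<partial>P) \<le> (\<integral>y. y\<^sup>2 * gamma_weight y \<partial>P)"
    proof (rule integral_mono[OF _ gi])
      show "integrable P (\<lambda>y. 2 * d * (y\<^sup>2 - y\<^sup>2 * indicator {-w..w} y))"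
        using J P_square by simp
      show "2 * d * (y\<^sup>2 - y\<^sup>2 * indicator {-w..w} y) \<le> y\<^sup>2 * gamma_weight y" for y
      proof (cases "y \<in> {-w..w}")
        case True then show ?thesis by (simp add: gamma_weight_nonneg)
      next
        case False
        then have "1.3 * d < \<bar>y\<bar>" by (auto simp: w_def abs_if)
        from mult_left_mono[OF gamma_weight_ge_double[OF d(2) this], of "y\<^sup>2"] False
        show ?thesis by (simp add: mult_ac)
      qed
    qed
    also have "(\<integral>y. 2 * d * (y\<^sup>2 - y\<^sup>2 * indicator {-w..w} y) \<partial>P)
        = 2 * d * ((\<integral>y. y\<^sup>2 \<partial>P) - (\<integral>y. y\<^sup>2 * indicator {-w..w} y \<partial>P))"
      using J P_square by simp
    finally have "m * (2 * d * ((\<integral>y. y\<^sup>2 \<partial>P) - (\<integral>y. y\<^sup>2 * indicator {-w..w} y \<partial>P))) \<le> d"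
      unfolding d(1) using m_pos by (intro mult_left_mono) auto
    also have "m * (2 * d * ((\<integral>y. y\<^sup>2 \<partial>P) - (\<integral>y. y\<^sup>2 * indicator {-w..w} y \<partial>P)))
        = d * (2 * (m * (\<integral>y. y\<^sup>2 \<partial>P) - m * (\<integral>y. y\<^sup>2 * indicator {-w..w} y \<partial>P)))"
      by (simp add: algebra_simps)
    finally have "2 * (1 - m * (\<integral>y. y\<^sup>2 * indicator {-w..w} y \<partial>P)) \<le> 1"
      using d0 unfolding P_var by simp
    then show ?thesis by simp
  qed
  let ?\<beta> = "\<lambda>y. min 1 (sqrt 2 * \<bar>y\<bar> / 6) + min 1 (2 * \<bar>y\<bar> / 3)"
  have "(\<integral>y. y\<^sup>2 * ?\<beta> y \<partial>P) \<le> (\<integral>y. 2.2 * (y\<^sup>2 * gamma_weight y) \<partial>P)"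
  proof (rule integral_mono)
    show "integrable P (\<lambda>y. y\<^sup>2 * ?\<beta> y)"
      by (rule Bochner_Integration.integrable_bound[where f = "\<lambda>y. y\<^sup>2 * 2"])
         (auto intro!: P_square AE_I2 mult_left_mono simp: abs_mult)
    show "integrable P (\<lambda>y. 2.2 * (y\<^sup>2 * gamma_weight y))" using gi by simp
    show "y\<^sup>2 * ?\<beta> y \<le> 2.2 * (y\<^sup>2 * gamma_weight y)" for y
      using mult_left_mono[OF min_sum_le_gamma_weight[of y], of "y\<^sup>2"] by (simp add: mult_ac)
  qed
  then have "m * (\<integral>y. y\<^sup>2 * ?\<beta> y \<partial>P) \<le> m * (\<integral>y. 2.2 * (y\<^sup>2 * gamma_weight y) \<partial>P)"
    using m_pos by (intro mult_left_mono) auto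
  also have "\<dots> = 2.2 * d" by (simp add: d(1))
  finally show ?thesis
    using S_interval_laplace[OF ab w S_interval_le[OF w _ half]] unfolding w_def by linarith
qed

end

section \<open>Geometric random sums\<close>

lemma (in prob_space) nn_integral_indep_var:
  assumes ind: "indep_var N1 A N2 B" and f: "f \<in> borel_measurable (N1 \<Otimes>\<^sub>M N2)"
  shows "(\<integral>\<^sup>+\<omega>. f (A \<omega>, B \<omega>) \<partial>M) = (\<integral>\<^sup>+a. \<integral>\<^sup>+b. f (a, b) \<partial>distr M N2 B \<partial>distr M N1 A)"
proof -
  have [measurable]: "A \<in> measurable M N1" "B \<in> measurable M N2"
    using indep_var_rv1[OF ind] indep_var_rv2[OF ind] by auto
  interpret B: prob_space "distr M N2 B" by (rule prob_space_distr) simp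
  have "(\<integral>\<^sup>+\<omega>. f (A \<omega>, B \<omega>) \<partial>M) = (\<integral>\<^sup>+z. f z \<partial>distr M (N1 \<Otimes>\<^sub>M N2) (\<lambda>\<omega>. (A \<omega>, B \<omega>)))"
    by (subst nn_integral_distr) (use f in auto)
  also have "distr M (N1 \<Otimes>\<^sub>M N2) (\<lambda>\<omega>. (A \<omega>, B \<omega>)) = distr M N1 A \<Otimes>\<^sub>M distr M N2 B"
    using ind unfolding indep_var_distribution_eq by simp
  also have "(\<integral>\<^sup>+z. f z \<partial>(distr M N1 A \<Otimes>\<^sub>M distr M N2 B))
      = (\<integral>\<^sup>+a. \<integral>\<^sup>+b. f (a, b) \<partial>distr M N2 B \<partial>distr M N1 A)"
    by (rule B.nn_integral_fst[symmetric]) (use f in simp)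
  finally show ?thesis .
qed

text \<open>The geometric law has mean \<open>m\<close>. The differentiated geometric series
  supplies the terms from index 1 on, and the term at index 0 is zero.\<close>

lemma geometric_mean_sums:
  fixes m :: real
  assumes "0 < m"
  shows "(\<lambda>k. 1 / (m + 1) * (m / (m + 1)) ^ k * (real k / m)) sums 1"
proof -
  define z where "z = m / (m + 1)"
  have z: "norm z < 1" and z1: "1 - z = 1 / (m + 1)"
    using assms by (auto simp: z_def field_simps)
  have "(\<lambda>k. 1 / (m + 1) * z / m * (real (Suc k) * z ^ k)) sums (1 / (m + 1) * z / m * (1 / (1 - z)\<^sup>2))"
    by (rule sums_mult[OF geometric_deriv_sums[OF z]])
  moreover have one: "1 / (m + 1) * z / m * (1 / (1 - z)\<^sup>2) = 1"
    unfolding z1 using assms by (simp add: z_def power2_eq_square)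
  ultimately have "(\<lambda>k. 1 / (m + 1) * z ^ Suc k * (real (Suc k) / m)) sums 1"
    unfolding one by (simp add: mult_ac)
  then have "(\<lambda>k. 1 / (m + 1) * z ^ k * (real k / m)) sums (1 + 1 / (m + 1) * z ^ 0 * (real 0 / m))"
    by (rule sums_Suc)
  then show ?thesis by (simp add: z_def)
qed

text \<open>The summands are already rescaled: their variance \<open>1 / m\<close> against the mean
  \<open>m\<close> of \<open>N\<close> normalises the random sum to variance 1.\<close>

locale geometric_sum = prob_space M
  for M :: "'a measure" and Y :: "nat \<Rightarrow> 'a \<Rightarrow> real" and N :: "'a \<Rightarrow> nat" and m :: real +
  assumes same_law: "\<And>i. 1 \<le> i \<Longrightarrow> distr M borel (Y i) = distr M borel (Y 1)"
    and m_pos: "0 < m"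
    and square_int: "integrable M (\<lambda>\<omega>. (Y 1 \<omega>)\<^sup>2)"
    and mean_0: "(\<integral>\<omega>. Y 1 \<omega> \<partial>M) = 0"
    and var: "(\<integral>\<omega>. (Y 1 \<omega>)\<^sup>2 \<partial>M) = 1 / m"
    and N_law: "\<And>k. prob {\<omega> \<in> space M. N \<omega> = k} = 1 / (m + 1) * (m / (m + 1)) ^ k"
    and indep: "indep_vars (\<lambda>_. borel) (\<lambda>i. if i = 0 then (\<lambda>\<omega>. real (N \<omega>)) else Y i) UNIV"
begin

definition "partial_sum k \<omega> = (\<Sum>i=1..k. Y i \<omega>)" for k \<omega>
definition "random_sum \<omega> = (\<Sum>i=1..N \<omega>. Y i \<omega>)" for \<omega>

lemma Y_measurable: "1 \<le> i \<Longrightarrow> Y i \<in> borel_measurable M"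
  and N_measurable: "(\<lambda>\<omega>. real (N \<omega>)) \<in> borel_measurable M"
  using indep unfolding indep_vars_def by (force split: if_splits)+

lemma partial_sum_measurable [measurable]: "partial_sum k \<in> borel_measurable M"
  unfolding partial_sum_def[abs_def] by (intro borel_measurable_sum Y_measurable) auto

lemma N_measurable_count [measurable]: "N \<in> measurable M (count_space UNIV)"
proof -
  have "(\<lambda>\<omega>. nat \<lfloor>real (N \<omega>)\<rfloor>) \<in> measurable M (count_space UNIV)"
    using N_measurable by measurable
  then show ?thesis by simp
qed

lemma random_sum_eq: "random_sum \<omega> = partial_sum (N \<omega>) \<omega>"
  by (simp add: random_sum_def partial_sum_def)

lemma random_sum_measurable [measurable]: "random_sum \<in> borel_measurable M"
  unfolding random_sum_eq[abs_def]
  by (rule measurable_compose_countable[where f = partial_sum and g = N]) measurable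

text \<open>Both cases concern one member of the independent family whose index, 0 or
  \<open>Suc k\<close>, lies outside \<open>{1..k}\<close>.\<close>

lemma indep_partial_sum:
  "indep_var borel (\<lambda>\<omega>. real (N \<omega>)) borel (partial_sum k)"
  "indep_var borel (Y (Suc k)) borel (partial_sum k)"
proof -
  let ?Z = "\<lambda>i. if i = 0 then (\<lambda>\<omega>. real (N \<omega>)) else Y i"
  have sum: "(\<lambda>\<omega>. \<Sum>i\<in>{1..k}. ?Z i \<omega>) = partial_sum k"
    unfolding partial_sum_def by (intro ext sum.cong) auto
  have *: "indep_var borel (?Z j) borel (partial_sum k)" if "j \<notin> {1..k}" for j
    unfolding sum[symmetric]
    by (rule indep_vars_sum) (use that in \<open>auto intro: indep_vars_subset[OF indep]\<close>)
  show "indep_var borel (\<lambda>\<omega>. real (N \<omega>)) borel (partial_sum k)"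
    "indep_var borel (Y (Suc k)) borel (partial_sum k)"
    using *[of 0] *[of "Suc k"] by simp_all
qed

definition "law = distr M borel (Y 1)"
definition "sum_law = distr M borel random_sum"

lemma Y_measurable_1 [measurable]: "Y (Suc 0) \<in> borel_measurable M"
  using Y_measurable[of 1] by simp

lemma partial_sum_0: "partial_sum 0 \<omega> = 0"
  and partial_sum_Suc: "partial_sum (Suc k) \<omega> = Y (Suc k) \<omega> + partial_sum k \<omega>"
  by (simp_all add: partial_sum_def)

lemma prob_space_law: "prob_space law" "prob_space sum_law"
  unfolding law_def sum_law_def by (auto intro!: prob_space_distr)

lemma nn_integral_partial_sum_Suc:
  assumes [measurable]: "h \<in> borel_measurable borel"
  shows "(\<integral>\<^sup>+\<omega>. h (partial_sum (Suc k) \<omega>) \<partial>M) = (\<integral>\<^sup>+\<omega>. (\<integral>\<^sup>+y. h (partial_sum k \<omega> + y) \<partial>law) \<partial>M)"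
proof -
  interpret L: prob_space law by (rule prob_space_law)
  interpret T: prob_space "distr M borel (partial_sum k)" by (rule prob_space_distr) simp
  interpret TL: pair_sigma_finite "distr M borel (partial_sum k)" law ..
  have [measurable_cong]: "sets law = sets borel" by (simp add: law_def)
  have Yk: "distr M borel (Y (Suc k)) = law" unfolding law_def by (rule same_law) simp
  have "(\<integral>\<^sup>+\<omega>. h (partial_sum (Suc k) \<omega>) \<partial>M)
      = (\<integral>\<^sup>+y. \<integral>\<^sup>+t. h (y + t) \<partial>distr M borel (partial_sum k) \<partial>law)"
    using nn_integral_indep_var[OF indep_partial_sum(2)[of k], of "\<lambda>(y, t). h (y + t)"]
    by (simp add: partial_sum_Suc Yk)
  also have "\<dots> = (\<integral>\<^sup>+t. \<integral>\<^sup>+y. h (y + t) \<partial>law \<partial>distr M borel (partial_sum k))"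
    by (rule TL.Fubini') measurable
  also have "\<dots> = (\<integral>\<^sup>+\<omega>. (\<integral>\<^sup>+y. h (partial_sum k \<omega> + y) \<partial>law) \<partial>M)"
    by (subst nn_integral_distr) (auto simp: add.commute)
  finally show ?thesis .
qed

text \<open>Decomposition by the value of \<open>N\<close>; each term factorises because
  \<open>N\<close> is independent of \<open>partial_sum k\<close>.\<close>

lemma nn_integral_sum_law:
  assumes [measurable]: "h \<in> borel_measurable borel"
  shows "(\<integral>\<^sup>+s. h s \<partial>sum_law)
    = (\<Sum>k. ennreal (1 / (m + 1) * (m / (m + 1)) ^ k) * (\<integral>\<^sup>+\<omega>. h (partial_sum k \<omega>) \<partial>M))"
proof -
  have split: "h (random_sum \<omega>) = (\<Sum>k. indicator {real k} (real (N \<omega>)) * h (partial_sum k \<omega>))" for \<omega>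
  proof -
    have "(\<Sum>k. indicator {real k} (real (N \<omega>)) * h (partial_sum k \<omega>))
        = (\<Sum>k\<in>{N \<omega>}. indicator {real k} (real (N \<omega>)) * h (partial_sum k \<omega>))"
      by (rule suminf_finite) auto
    then show ?thesis by (simp add: random_sum_eq)
  qed
  have "(\<integral>\<^sup>+s. h s \<partial>sum_law) = (\<integral>\<^sup>+\<omega>. h (random_sum \<omega>) \<partial>M)"
    unfolding sum_law_def by (rule nn_integral_distr) auto
  also have "\<dots> = (\<Sum>k. \<integral>\<^sup>+\<omega>. indicator {real k} (real (N \<omega>)) * h (partial_sum k \<omega>) \<partial>M)"
    unfolding split by (rule nn_integral_suminf) measurable
  also have "\<dots> = (\<Sum>k. ennreal (1 / (m + 1) * (m / (m + 1)) ^ k) * (\<integral>\<^sup>+\<omega>. h (partial_sum k \<omega>) \<partial>M))"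
  proof (rule arg_cong[where f = suminf], rule ext)
    fix k
    have "(\<integral>\<^sup>+\<omega>. indicator {real k} (real (N \<omega>)) * h (partial_sum k \<omega>) \<partial>M)
      = (\<integral>\<^sup>+a. \<integral>\<^sup>+t. indicator {real k} a * h t \<partial>distr M borel (partial_sum k) \<partial>distr M borel (\<lambda>\<omega>. real (N \<omega>)))"
      using nn_integral_indep_var[OF indep_partial_sum(1)[of k], of "\<lambda>(a, t). indicator {real k} a * h t"]
      by simp
    also have "\<dots> = (\<integral>\<^sup>+a. indicator {real k} a * (\<integral>\<^sup>+\<omega>. h (partial_sum k \<omega>) \<partial>M) \<partial>distr M borel (\<lambda>\<omega>. real (N \<omega>)))"
      by (simp add: nn_integral_cmult nn_integral_distr)
    also have "\<dots> = emeasure (distr M borel (\<lambda>\<omega>. real (N \<omega>))) {real k} * (\<integral>\<^sup>+\<omega>. h (partial_sum k \<omega>) \<partial>M)"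
      by (simp add: nn_integral_multc)
    also have "emeasure (distr M borel (\<lambda>\<omega>. real (N \<omega>))) {real k} = emeasure M {\<omega> \<in> space M. N \<omega> = k}"
      by (subst emeasure_distr) (auto intro!: arg_cong[where f = "emeasure M"])
    also have "\<dots> = ennreal (1 / (m + 1) * (m / (m + 1)) ^ k)"
      unfolding emeasure_eq_measure N_law ..
    finally show "(\<integral>\<^sup>+\<omega>. indicator {real k} (real (N \<omega>)) * h (partial_sum k \<omega>) \<partial>M)
      = ennreal (1 / (m + 1) * (m / (m + 1)) ^ k) * (\<integral>\<^sup>+\<omega>. h (partial_sum k \<omega>) \<partial>M)" .
  qed
  finally show ?thesis .
qed

text \<open>Memorylessness in terms of the weights: \<open>(m + 1) * p 0 = 1\<close> and
  \<open>(m + 1) * p (Suc k) = m * p k\<close>. Splitting off the term at 0 and shifting the index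
  leaves one extra independent summand.\<close>

lemma sum_law_mixture:
  assumes [measurable]: "h \<in> borel_measurable borel"
  shows "ennreal (m + 1) * (\<integral>\<^sup>+s. h s \<partial>sum_law) = h 0 + ennreal m * (\<integral>\<^sup>+s. \<integral>\<^sup>+y. h (s + y) \<partial>law \<partial>sum_law)"
proof -
  interpret L: prob_space law by (rule prob_space_law)
  have [measurable_cong]: "sets law = sets borel" by (simp add: law_def)
  define p where "p k = ennreal (1 / (m + 1) * (m / (m + 1)) ^ k)" for k
  define F where "F s = (\<integral>\<^sup>+y. h (s + y) \<partial>law)" for s
  have [measurable]: "F \<in> borel_measurable borel" unfolding F_def[abs_def] by measurable
  have p0: "ennreal (m + 1) * p 0 = 1"
    unfolding p_def by (subst ennreal_mult[symmetric]) (use m_pos in auto)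
  have pS: "ennreal (m + 1) * p (Suc k) = ennreal m * p k" for k
  proof -
    have "(m + 1) * (1 / (m + 1) * (m / (m + 1)) ^ Suc k) = m * (1 / (m + 1) * (m / (m + 1)) ^ k)"
      using m_pos by simp
    then show ?thesis
      unfolding p_def using m_pos by (subst (1 2) ennreal_mult[symmetric]) auto
  qed
  have "ennreal (m + 1) * (\<integral>\<^sup>+s. h s \<partial>sum_law)
      = (\<Sum>k. ennreal (m + 1) * p k * (\<integral>\<^sup>+\<omega>. h (partial_sum k \<omega>) \<partial>M))"
    by (simp add: nn_integral_sum_law p_def mult.assoc)
  also have "\<dots> = (\<Sum>k. ennreal (m + 1) * p (Suc k) * (\<integral>\<^sup>+\<omega>. h (partial_sum (Suc k) \<omega>) \<partial>M))
      + ennreal (m + 1) * p 0 * (\<integral>\<^sup>+\<omega>. h (partial_sum 0 \<omega>) \<partial>M)"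
    by (rule sums_unique[symmetric], rule sums_Suc) (rule summable_sums[OF summableI])
  also have "\<dots> = (\<Sum>k. ennreal m * (p k * (\<integral>\<^sup>+\<omega>. F (partial_sum k \<omega>) \<partial>M))) + h 0"
    unfolding p0 pS nn_integral_partial_sum_Suc[OF assms] F_def
    by (simp add: partial_sum_0 mult.assoc emeasure_space_1)
  also have "\<dots> = ennreal m * (\<integral>\<^sup>+s. F s \<partial>sum_law) + h 0"
    by (simp add: nn_integral_sum_law p_def)
  finally show ?thesis by (simp add: F_def add.commute)
qed

lemma Y_moments:
  assumes "1 \<le> i"
  shows "integrable M (\<lambda>\<omega>. (Y i \<omega>)\<^sup>2)" "(\<integral>\<omega>. (Y i \<omega>)\<^sup>2 \<partial>M) = 1 / m" "(\<integral>\<omega>. Y i \<omega> \<partial>M) = 0"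
proof -
  note [measurable] = Y_measurable[OF assms]
  have "integrable (distr M borel (Y i)) (\<lambda>y. y\<^sup>2)"
    unfolding same_law[OF assms] using square_int by (subst integrable_distr_eq) auto
  then show "integrable M (\<lambda>\<omega>. (Y i \<omega>)\<^sup>2)" by (subst (asm) integrable_distr_eq) auto
  have "(\<integral>y. y\<^sup>2 \<partial>distr M borel (Y i)) = 1 / m" "(\<integral>y. y \<partial>distr M borel (Y i)) = 0"
    unfolding same_law[OF assms] using var mean_0 by (simp_all add: integral_distr)
  then show "(\<integral>\<omega>. (Y i \<omega>)\<^sup>2 \<partial>M) = 1 / m" "(\<integral>\<omega>. Y i \<omega> \<partial>M) = 0"
    by (simp_all add: integral_distr)
qed

text \<open>The cross term in the square of the next partial sum has mean 0 by independence and
  centring.\<close>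

lemma partial_sum_moments:
  "integrable M (\<lambda>\<omega>. (partial_sum k \<omega>)\<^sup>2)" "(\<integral>\<omega>. (partial_sum k \<omega>)\<^sup>2 \<partial>M) = real k / m"
proof (induction k)
  case (Suc k)
  note [measurable] = Y_measurable[of "Suc k", simplified]
  note Y = Y_moments[of "Suc k", simplified]
  have i: "integrable M (Y (Suc k))" "integrable M (partial_sum k)"
    using Y(1) Suc.IH(1) by (auto intro: square_integrable_imp_integrable)
  note XY = indep_var_integrable[OF indep_partial_sum(2) i] indep_var_lebesgue_integral[OF indep_partial_sum(2) i]
  have eq: "(partial_sum (Suc k) \<omega>)\<^sup>2 = (Y (Suc k) \<omega>)\<^sup>2 + 2 * (Y (Suc k) \<omega> * partial_sum k \<omega>) + (partial_sum k \<omega>)\<^sup>2" for \<omega>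
    by (simp add: partial_sum_Suc power2_sum)
  show "integrable M (\<lambda>\<omega>. (partial_sum (Suc k) \<omega>)\<^sup>2)"
    unfolding eq using XY Y Suc.IH by auto
  show "(\<integral>\<omega>. (partial_sum (Suc k) \<omega>)\<^sup>2 \<partial>M) = real (Suc k) / m"
    unfolding eq using XY Y Suc.IH m_pos by (simp add: add_divide_distrib)
qed (simp_all add: partial_sum_0)

lemma sum_law_square:
  "integrable sum_law (\<lambda>s. s\<^sup>2)" "(\<integral>s. s\<^sup>2 \<partial>sum_law) = 1"
proof -
  have [measurable_cong]: "sets sum_law = sets borel" by (simp add: sum_law_def)
  have "(\<integral>\<^sup>+s. ennreal (s\<^sup>2) \<partial>sum_law)
      = (\<Sum>k. ennreal (1 / (m + 1) * (m / (m + 1)) ^ k) * ennreal (real k / m))"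
    by (simp add: nn_integral_sum_law nn_integral_eq_integral partial_sum_moments)
  also have "\<dots> = (\<Sum>k. ennreal (1 / (m + 1) * (m / (m + 1)) ^ k * (real k / m)))"
    using m_pos by (intro arg_cong[where f = suminf] ext ennreal_mult[symmetric]) auto
  also have "\<dots> = ennreal 1"
    using m_pos by (intro suminf_ennreal_eq geometric_mean_sums) auto
  finally have "has_bochner_integral sum_law (\<lambda>s. s\<^sup>2) 1"
    by (intro has_bochner_integral_nn_integral) auto
  then show "integrable sum_law (\<lambda>s. s\<^sup>2)" "(\<integral>s. s\<^sup>2 \<partial>sum_law) = 1"
    by (auto simp: has_bochner_integral_iff)
qed

lemma geometric_law_sum_law: "geometric_law sum_law law m"
proof (intro geometric_law.intro prob_space_law geometric_law_axioms.intro)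
  show "integrable law (\<lambda>y. y\<^sup>2)" "(\<integral>y. y \<partial>law) = 0" "m * (\<integral>y. y\<^sup>2 \<partial>law) = 1"
    using square_int mean_0 var m_pos by (simp_all add: law_def integrable_distr_eq integral_distr)
qed (simp_all add: sum_law_def[THEN arg_cong[of _ _ sets]] law_def[THEN arg_cong[of _ _ sets]]
      m_pos sum_law_square sum_law_mixture)

end

section \<open>The concentration function\<close>

lemma (in prob_space) concentration_fun_bounds:
  "0 \<le> concentration_fun M \<xi> z" "concentration_fun M \<xi> z \<le> 1"
  "\<P>(\<omega> in M. x \<le> \<xi> \<omega> \<and> \<xi> \<omega> \<le> x + z) \<le> concentration_fun M \<xi> z"
proof -
  have bdd: "bdd_above (range (\<lambda>x. \<P>(\<omega> in M. x \<le> \<xi> \<omega> \<and> \<xi> \<omega> \<le> x + z)))"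
    by (rule bdd_aboveI[of _ 1]) auto
  show upper: "\<P>(\<omega> in M. x \<le> \<xi> \<omega> \<and> \<xi> \<omega> \<le> x + z) \<le> concentration_fun M \<xi> z" for x
    unfolding concentration_fun_def by (rule cSUP_upper[OF UNIV_I bdd])
  show "0 \<le> concentration_fun M \<xi> z" by (rule order_trans[OF measure_nonneg upper])
  show "concentration_fun M \<xi> z \<le> 1"
    unfolding concentration_fun_def by (rule cSUP_least) auto
qed

text \<open>The interval estimate is uniform in position, so it passes to suprema: the upper bound
  uses that no interval of length \<open>z / c\<close> has larger Laplace mass than the centred one,
  the lower bound tests the centred interval only.\<close>

lemma (in geometric_sum) concentration_fun_random_sum:
  assumes z: "0 \<le> z" and c: "0 < c" and sum: "\<And>\<omega>. \<xi> \<omega> = c * random_sum \<omega>"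
    and d: "d = m * (\<integral>y. y\<^sup>2 * gamma_weight y \<partial>law)" "d \<le> 0.1348"
  shows "\<bar>concentration_fun M \<xi> z - (1 - exp (- (sqrt 2 * (z / c) / 2)))\<bar> \<le> 7.4 * d"
proof -
  interpret G: geometric_law sum_law law m by (rule geometric_law_sum_law)
  have zc: "0 \<le> z / c" using z c by simp
  have prob: "\<P>(\<omega> in M. x \<le> \<xi> \<omega> \<and> \<xi> \<omega> \<le> x + z) = measure sum_law {x / c..x / c + z / c}" for x
    unfolding sum_law_def using c
    by (subst measure_distr) (auto intro!: arg_cong[where f = prob] simp: sum field_simps)
  note B = G.S_interval_gamma_weight[OF _ d]
  have "concentration_fun M \<xi> z \<le> (1 - exp (- (sqrt 2 * (z / c) / 2))) + 7.4 * d"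
    unfolding concentration_fun_def
  proof (rule cSUP_least)
    fix x
    show "\<P>(\<omega> in M. x \<le> \<xi> \<omega> \<and> \<xi> \<omega> \<le> x + z) \<le> (1 - exp (- (sqrt 2 * (z / c) / 2))) + 7.4 * d"
      unfolding prob using B[of "x / c" "x / c + z / c"] laplace_cdf_diff_le[OF zc, of "x / c"] zc by linarith
  qed simp
  moreover have "(1 - exp (- (sqrt 2 * (z / c) / 2))) - 7.4 * d \<le> concentration_fun M \<xi> z"
  proof -
    let ?x = "- z / 2"
    have e: "?x / c = - (z / c) / 2" "- (z / c) / 2 + z / c = (z / c) / 2" using c by (auto simp: field_simps)
    have "\<bar>measure sum_law {?x / c..?x / c + z / c} - (1 - exp (- (sqrt 2 * (z / c) / 2)))\<bar> \<le> 7.4 * d"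
      unfolding e laplace_cdf_diff_symmetric[OF zc, symmetric] using zc by (intro B) simp
    then show ?thesis using concentration_fun_bounds(3)[of ?x \<xi> z] unfolding prob by linarith
  qed
  ultimately show ?thesis by linarith
qed

theorem corollary4:
  fixes M :: "'a measure" and X :: "nat \<Rightarrow> 'a \<Rightarrow> real" and N :: "'a \<Rightarrow> nat"
    and \<sigma> :: real and n :: nat
  assumes "prob_space M"
    and "\<And>i. i \<ge> 1 \<Longrightarrow> distr M borel (X i) = distr M borel (X 1)"
    and "integrable M (\<lambda>\<omega>. (X 1 \<omega>)\<^sup>2)"
    and "(\<integral>\<omega>. X 1 \<omega> \<partial>M) = 0"
    and "(\<integral>\<omega>. (X 1 \<omega>)\<^sup>2 \<partial>M) = \<sigma>\<^sup>2"
    and "\<sigma> > 0"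
    and "n \<ge> 1"
    and "\<And>k. \<P>(\<omega> in M. N \<omega> = k) = 1 / (real n + 1) * (real n / (real n + 1)) ^ k"
    \<comment> \<open>joint independence of \<open>N, X 1, X 2, \<dots>\<close>, with \<open>N\<close> placed at index 0\<close>
    and "prob_space.indep_vars M (\<lambda>_. borel)
           (\<lambda>i. if i = 0 then (\<lambda>\<omega>. real (N \<omega>)) else X i) UNIV"
  shows "(SUP z\<in>{0..}. \<bar>concentration_fun M (\<lambda>\<omega>. \<Sum>i=1..N \<omega>. X i \<omega>) z
                          - 1 + exp (- (sqrt 2 * z / (2 * \<sigma> * sqrt (real n))))\<bar>)
       \<le> 7.4184 / \<sigma>\<^sup>2 *
          ((\<integral>\<omega>. (X 1 \<omega>)\<^sup>2 * lower_gamma 1 ((X 1 \<omega>)\<^sup>2 / (real n * \<sigma>\<^sup>2)) \<partial>M)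
           + 1 / (\<sigma> * sqrt (real n)) *
             (\<integral>\<omega>. \<bar>X 1 \<omega>\<bar> ^ 3 * upper_gamma (1 / 2) ((X 1 \<omega>)\<^sup>2 / (real n * \<sigma>\<^sup>2)) \<partial>M))"
proof -
  interpret prob_space M by fact
  \<comment> \<open>The standard deviation of the random sum, since \<open>N\<close> has mean
    \<open>n\<close>.\<close>
  define c where "c = \<sigma> * sqrt (real n)"
  have c: "0 < c" and c2: "c\<^sup>2 = real n * \<sigma>\<^sup>2" and n: "0 < real n"
    using assms(6,7) by (auto simp: c_def power_mult_distrib)
  define Y where "Y i \<omega> = X i \<omega> / c" for i \<omega>
  have X [measurable]: "X i \<in> borel_measurable M" if "1 \<le> i" for i
    using assms(9) that unfolding indep_vars_def by (force split: if_splits)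
  have [measurable]: "X (Suc 0) \<in> borel_measurable M" using X[of 1] by simp
  have Y_distr: "distr M borel (Y i) = distr (distr M borel (X i)) borel (\<lambda>x. x / c)" if "1 \<le> i" for i
    using X[OF that] by (subst distr_distr) (auto simp: comp_def Y_def[abs_def])
  interpret G: geometric_sum M Y N "real n"
  proof unfold_locales
    show "distr M borel (Y i) = distr M borel (Y 1)" if "1 \<le> i" for i
      using Y_distr[OF that] Y_distr[of 1] assms(2)[OF that] by simp
    show "0 < real n" by (rule n)
    show "integrable M (\<lambda>\<omega>. (Y 1 \<omega>)\<^sup>2)" "(\<integral>\<omega>. Y 1 \<omega> \<partial>M) = 0" "(\<integral>\<omega>. (Y 1 \<omega>)\<^sup>2 \<partial>M) = 1 / real n"
      using assms(3-6) by (auto simp: Y_def power_divide c2)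
    show "prob {\<omega> \<in> space M. N \<omega> = k} = 1 / (real n + 1) * (real n / (real n + 1)) ^ k" for k
      by (rule assms(8))
    have "indep_vars (\<lambda>_. borel) (\<lambda>i \<omega>. (if i = 0 then id else (\<lambda>x. x / c))
        ((if i = 0 then (\<lambda>\<omega>. real (N \<omega>)) else X i) \<omega>)) UNIV"
      by (rule indep_vars_compose2[OF assms(9)]) auto
    also have "(\<lambda>i \<omega>. (if i = 0 then id else (\<lambda>x. x / c)) ((if i = 0 then (\<lambda>\<omega>. real (N \<omega>)) else X i) \<omega>))
        = (\<lambda>i. if i = 0 then (\<lambda>\<omega>. real (N \<omega>)) else Y i)"
      by (intro ext) (auto simp: Y_def)
    finally show "indep_vars (\<lambda>_. borel) (\<lambda>i. if i = 0 then (\<lambda>\<omega>. real (N \<omega>)) else Y i) UNIV" .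
  qed
  interpret L: geometric_law G.sum_law G.law "real n" by (rule G.geometric_law_sum_law)
  define d where "d = real n * (\<integral>y. y\<^sup>2 * gamma_weight y \<partial>G.law)"
  have sum: "(\<Sum>i=1..N \<omega>. X i \<omega>) = c * G.random_sum \<omega>" for \<omega>
    using c by (simp add: G.random_sum_def Y_def sum_divide_distrib[symmetric])
  let ?I1 = "\<integral>\<omega>. (X 1 \<omega>)\<^sup>2 * lower_gamma 1 ((X 1 \<omega>)\<^sup>2 / (real n * \<sigma>\<^sup>2)) \<partial>M"
  let ?I2 = "\<integral>\<omega>. \<bar>X 1 \<omega>\<bar> ^ 3 * upper_gamma (1 / 2) ((X 1 \<omega>)\<^sup>2 / (real n * \<sigma>\<^sup>2)) \<partial>M"
  let ?f1 = "\<lambda>y::real. y\<^sup>2 * (1 - exp (- y\<^sup>2))" and ?f2 = "\<lambda>y::real. y\<^sup>2 * (\<bar>y\<bar> * upper_gamma (1/2) (y\<^sup>2))"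
  have f12: "y\<^sup>2 * gamma_weight y = ?f1 y + ?f2 y" for y
    by (simp add: gamma_weight_def distrib_left)
  have f1: "integrable G.law ?f1"
    by (rule Bochner_Integration.integrable_bound[OF L.P_square])
       (auto intro!: AE_I2 mult_left_le simp: abs_mult)
  have "integrable G.law (\<lambda>y. y\<^sup>2 * gamma_weight y)"
    by (rule Bochner_Integration.integrable_bound[where f = "\<lambda>y. y\<^sup>2 * 2"])
       (auto intro!: L.P_square AE_I2 mult_left_mono gamma_weight_le_2 simp: abs_mult gamma_weight_nonneg)
  from Bochner_Integration.integrable_diff[OF this f1] have f2: "integrable G.law ?f2"
    by (simp add: f12)
  have I1: "?I1 = c\<^sup>2 * (\<integral>y. ?f1 y \<partial>G.law)"
  proof -
    have "?I1 = (\<integral>\<omega>. c\<^sup>2 * ?f1 (Y 1 \<omega>) \<partial>M)"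
      using c by (intro Bochner_Integration.integral_cong refl)
        (simp add: c2[symmetric] lower_gamma_1 Y_def power_divide)
    then show ?thesis unfolding G.law_def by (subst integral_distr) auto
  qed
  \<comment> \<open>Rescaling the cubic moment produces \<open>c ^ 3\<close>; the factor
    \<open>1 / c\<close> reduces it to the same \<open>c\<^sup>2\<close> as in \<open>I1\<close>, so
    both integrals combine into one with \<open>gamma_weight\<close>.\<close>
  have I2: "1 / c * ?I2 = c\<^sup>2 * (\<integral>y. ?f2 y \<partial>G.law)"
  proof -
    have "\<bar>X 1 \<omega>\<bar> ^ 3 * upper_gamma (1 / 2) ((X 1 \<omega>)\<^sup>2 / (real n * \<sigma>\<^sup>2)) = c ^ 3 * ?f2 (Y 1 \<omega>)" for \<omega>
    proof -
      have "\<bar>X 1 \<omega>\<bar> = c * \<bar>Y 1 \<omega>\<bar>" "(X 1 \<omega>)\<^sup>2 / (real n * \<sigma>\<^sup>2) = (Y 1 \<omega>)\<^sup>2"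
        using c by (auto simp: Y_def power_divide c2)
      moreover have "\<bar>Y 1 \<omega>\<bar> ^ 3 = (Y 1 \<omega>)\<^sup>2 * \<bar>Y 1 \<omega>\<bar>"
        by (simp add: power3_eq_cube power2_eq_square)
      ultimately show ?thesis by (simp only: power_mult_distrib mult.assoc)
    qed
    then have "?I2 = (\<integral>\<omega>. c ^ 3 * ?f2 (Y 1 \<omega>) \<partial>M)" by (simp only:)
    also have "\<dots> = c ^ 3 * (\<integral>y. ?f2 y \<partial>G.law)"
      unfolding G.law_def by (subst integral_distr) auto
    finally show ?thesis using c by (simp add: power2_eq_square power3_eq_cube)
  qed
  have rhs: "7.4184 / \<sigma>\<^sup>2 * (?I1 + 1 / (\<sigma> * sqrt (real n)) * ?I2) = 7.4184 * d"
  proof -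
    have "(\<integral>y. y\<^sup>2 * gamma_weight y \<partial>G.law) = (\<integral>y. ?f1 y \<partial>G.law) + (\<integral>y. ?f2 y \<partial>G.law)"
      unfolding f12 by (rule Bochner_Integration.integral_add[OF f1 f2])
    then have "?I1 + 1 / c * ?I2 = \<sigma>\<^sup>2 * d"
      unfolding I1 I2 d_def c2 by (simp add: algebra_simps)
    then show ?thesis using assms(6) by (simp add: c_def[symmetric])
  qed
  have "0 \<le> (\<integral>y. y\<^sup>2 * gamma_weight y \<partial>G.law)"
    by (intro integral_nonneg_AE AE_I2 mult_nonneg_nonneg gamma_weight_nonneg) simp
  then have d0: "0 \<le> d" by (simp add: d_def)
  show ?thesis
    unfolding rhs
  proof (rule cSUP_least)
    fix z :: real assume "z \<in> {0..}"
    then have z: "0 \<le> z" by simp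
    define q e where "q = concentration_fun M (\<lambda>\<omega>. \<Sum>i=1..N \<omega>. X i \<omega>) z"
      and "e = exp (- (sqrt 2 * z / (2 * \<sigma> * sqrt (real n))))"
    have e: "e = exp (- (sqrt 2 * (z / c) / 2))" by (simp add: e_def c_def mult_ac)
    have e01: "0 \<le> e" "e \<le> 1" using z c unfolding e by auto
    have q01: "0 \<le> q" "q \<le> 1" unfolding q_def by (rule concentration_fun_bounds)+
    have "\<bar>q - 1 + e\<bar> \<le> 7.4184 * d"
    proof (cases "d \<le> 0.1348")
      case True
      have "\<bar>q - (1 - e)\<bar> \<le> 7.4 * d"
        unfolding q_def e by (rule G.concentration_fun_random_sum[OF z c sum d_def True])
      moreover have "7.4 * d \<le> 7.4184 * d" using d0 by (intro mult_right_mono) auto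
      ultimately show ?thesis by (simp add: algebra_simps)
    next
      case False
      \<comment> \<open>The threshold is chosen so that 7.4184 * 0.1348 just exceeds 1, while
        \<open>q\<close> and \<open>e\<close> in the unit interval keep the error at most 1.\<close>
      then have "1 \<le> 7.4184 * d" by simp
      then show ?thesis using q01 e01 by linarith
    qed
    then show "\<bar>concentration_fun M (\<lambda>\<omega>. \<Sum>i=1..N \<omega>. X i \<omega>) z - 1
        + exp (- (sqrt 2 * z / (2 * \<sigma> * sqrt (real n))))\<bar> \<le> 7.4184 * d"
      by (simp only: q_def e_def)
  qed simp
qed

end
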